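(* Given an NMDA $\mathcal{A}$, it is decidable in time $O(|\mathcal{A}|^2)$ whether $\mathcal{A}$ is tidy.
   Context: An NMDA over a finite alphabet $\Sigma$ is a tuple $\mathcal{A}=\langle \Sigma,Q,\iota,\delta,\gamma,\rho\rangle$ with finite state set $Q$, initial states $\iota\subseteq Q$, transition relation $\delta\subseteq Q\times\Sigma\times Q$, weight function $\gamma:\delta\to\mathbb{Q}$ and discount-factor function $\rho:\delta\to\mathbb{Q}\cap(1,\infty)$; NMDAs are assumed complete. A run of $\mathcal{A}$ on $u=\sigma_1\cdots\sigma_n$ is $q_0,\sigma_1,q_1,\ldots,\sigma_n,q_n$ with $q_0\in\iota$ and $(q_{i-1},\sigma_i,q_i)\in\delta$. An NMDA is integral if all discount factors are integers. An integral NMDA $\mathcal{A}$ is tidy if there is a function $\theta:\Sigma^+\to\mathbb{N}\setminus\{0,1\}$ such that for every $u=\sigma_1\cdots\sigma_n\in\Sigma^+$ and every run $q_0,\sigma_1,\ldots,q_n$ of $\mathcal{A}$ on $u$, $\rho(q_{n-1},\sigma_n,q_n)=\theta(u)$. The size $|\mathcal{A}|$ is the maximum of the number of transitions and the maximal length of the binary representation of any weight or discount factor. *)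

theory Defs
  imports Complex_Main "HOL-Library.Landau_Symbols"
begin

section \<open>Discounted-sum automata with multiple discount factors\<close>

text \<open>Weights and discount factors are total functions; only their values on
  \<open>trans\<close> matter.\<close>

record ('a, 'q) nmda =
  alphabet :: "'a set"
  states   :: "'q set"
  init     :: "'q set"
  trans    :: "('q \<times> 'a \<times> 'q) set"
  weight   :: "'q \<times> 'a \<times> 'q \<Rightarrow> rat"
  discount :: "'q \<times> 'a \<times> 'q \<Rightarrow> rat"

definition is_nmda :: "('a, 'q) nmda \<Rightarrow> bool" where
  "is_nmda A \<longleftrightarrow>
     finite (alphabet A) \<and> finite (states A) \<and> init A \<subseteq> states A \<and>
     trans A \<subseteq> states A \<times> alphabet A \<times> states A \<and>
     (\<forall>e \<in> trans A. discount A e > 1) \<and>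
     (\<forall>q \<in> states A. \<forall>a \<in> alphabet A. \<exists>q'. (q, a, q') \<in> trans A)"

text \<open>The state sequence \<open>qs\<close> of a run on \<open>u\<close>: \<open>u ! i\<close> is the letter read
  between \<open>qs ! i\<close> and \<open>qs ! Suc i\<close>.\<close>

definition is_run :: "('a, 'q) nmda \<Rightarrow> 'a list \<Rightarrow> 'q list \<Rightarrow> bool" where
  "is_run A u qs \<longleftrightarrow>
     length qs = Suc (length u) \<and> qs ! 0 \<in> init A \<and>
     (\<forall>i < length u. (qs ! i, u ! i, qs ! Suc i) \<in> trans A)"

definition integral_nmda :: "('a, 'q) nmda \<Rightarrow> bool" where
  "integral_nmda A \<longleftrightarrow> (\<forall>e \<in> trans A. discount A e \<in> \<int>)"

definition tidy :: "('a, 'q) nmda \<Rightarrow> bool" where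
  "tidy A \<longleftrightarrow> integral_nmda A \<and>
     (\<exists>\<theta> :: 'a list \<Rightarrow> nat.
        (\<forall>u \<in> lists (alphabet A) - {[]}. \<theta> u \<notin> {0, 1}) \<and>
        (\<forall>u \<in> lists (alphabet A) - {[]}. \<forall>qs. is_run A u qs \<longrightarrow>
           discount A (qs ! (length u - 1), u ! (length u - 1), qs ! length u) = of_nat (\<theta> u)))"

text \<open>Binary digits, most significant first; zero is the one-digit word \<open>[0]\<close>.\<close>

fun binary :: "nat \<Rightarrow> nat list" where
  "binary n = (if n < 2 then [n] else binary (n div 2) @ [n mod 2])"

declare binary.simps [simp del]

text \<open>A rational is represented by numerator and denominator in lowest terms
  (\<open>quotient_of\<close>, with positive denominator).\<close>

definition binary_length :: "rat \<Rightarrow> nat" where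
  "binary_length r = (case quotient_of r of (p, q) \<Rightarrow>
     length (binary (nat \<bar>p\<bar>)) + length (binary (nat q)))"

definition nmda_size :: "('a, 'q) nmda \<Rightarrow> nat" where
  "nmda_size A =
     Max (insert (card (trans A)) (binary_length ` (weight A ` trans A \<union> discount A ` trans A)))"


section \<open>Word RAM\<close>

text \<open>A random access machine with finitely many program registers and an indirectly
  addressed memory, both holding natural numbers. Control flow is given by
  \<open>IfNZ\<close> and \<open>While\<close>, testing whether a register is nonzero.
  In \<open>Add x y z\<close>, \<open>Sub x y z\<close>, \<open>Mul x y z\<close> the register \<open>x\<close> is the target;
  \<open>Load x a\<close> sets \<open>x\<close> to the content of the cell whose address is in register \<open>a\<close>, and
  \<open>Store a x\<close> writes register \<open>x\<close> to that cell.\<close>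

datatype com =
    Skip
  | Const nat nat
  | Add nat nat nat
  | Sub nat nat nat
  | Mul nat nat nat
  | Load nat nat
  | Store nat nat
  | Seq com com
  | IfNZ nat com com
  | While nat com

type_synonym config = "(nat \<Rightarrow> nat) \<times> (nat \<Rightarrow> nat)"

text \<open>\<open>exec W c (r, m) t (r', m')\<close>: started with registers \<open>r\<close> and memory \<open>m\<close>, the program \<open>c\<close>
  terminates after \<open>t\<close> steps with \<open>r'\<close> and \<open>m'\<close>. Every instruction and every test counts as
  one step. A machine word holds the numbers below \<open>W\<close>: an instruction producing a larger value
  has no successor configuration. So a step acts on single words only,
  and a program that overflows does not terminate successfully.\<close>

inductive exec :: "nat \<Rightarrow> com \<Rightarrow> config \<Rightarrow> nat \<Rightarrow> config \<Rightarrow> bool" for W :: nat where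
  Skip: "exec W Skip (r, m) 1 (r, m)"
| Const: "n < W \<Longrightarrow> exec W (Const x n) (r, m) 1 (r(x := n), m)"
| Add: "r y + r z < W \<Longrightarrow> exec W (Add x y z) (r, m) 1 (r(x := r y + r z), m)"
| Sub: "r y - r z < W \<Longrightarrow> exec W (Sub x y z) (r, m) 1 (r(x := r y - r z), m)"
| Mul: "r y * r z < W \<Longrightarrow> exec W (Mul x y z) (r, m) 1 (r(x := r y * r z), m)"
| Load: "m (r a) < W \<Longrightarrow> exec W (Load x a) (r, m) 1 (r(x := m (r a)), m)"
| Store: "r x < W \<Longrightarrow> exec W (Store a x) (r, m) 1 (r, m(r a := r x))"
| Seq: "exec W c1 s t1 s' \<Longrightarrow> exec W c2 s' t2 s'' \<Longrightarrow> exec W (Seq c1 c2) s (t1 + t2) s''"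
| IfNZ_true: "r x \<noteq> 0 \<Longrightarrow> exec W c1 (r, m) t s' \<Longrightarrow> exec W (IfNZ x c1 c2) (r, m) (Suc t) s'"
| IfNZ_false: "r x = 0 \<Longrightarrow> exec W c2 (r, m) t s' \<Longrightarrow> exec W (IfNZ x c1 c2) (r, m) (Suc t) s'"
| While_true: "r x \<noteq> 0 \<Longrightarrow> exec W c (r, m) t1 s' \<Longrightarrow> exec W (While x c) s' t2 s'' \<Longrightarrow>
    exec W (While x c) (r, m) (Suc (t1 + t2)) s''"
| While_false: "r x = 0 \<Longrightarrow> exec W (While x c) (r, m) 1 (r, m)"

inductive_cases exec_SkipE: "exec W Skip (r, m) t s'"
inductive_cases exec_ConstE: "exec W (Const x n) (r, m) t s'"
inductive_cases exec_AddE: "exec W (Add x y z) (r, m) t s'"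
inductive_cases exec_SubE: "exec W (Sub x y z) (r, m) t s'"
inductive_cases exec_MulE: "exec W (Mul x y z) (r, m) t s'"
inductive_cases exec_LoadE: "exec W (Load x a) (r, m) t s'"
inductive_cases exec_StoreE: "exec W (Store a x) (r, m) t s'"
inductive_cases exec_SeqE: "exec W (Seq c1 c2) s t s'"
inductive_cases exec_IfNZE: "exec W (IfNZ x c1 c2) (r, m) t s'"
inductive_cases exec_WhileE: "exec W (While x c) (r, m) t s'"

lemma exec_deterministic:
  "exec W c s t s' \<Longrightarrow> exec W c s u s'' \<Longrightarrow> t = u \<and> s' = s''"
proof (induction arbitrary: u s'' rule: exec.induct)
  case (Seq c1 s t1 s' c2 t2 s2)
  show ?case
    by (rule exec_SeqE[OF Seq.prems]) (use Seq.IH in blast)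
next
  case (IfNZ_true r x c1 m t s' c2)
  show ?case
    by (rule exec_IfNZE[OF IfNZ_true.prems]) (use IfNZ_true.hyps(1) IfNZ_true.IH in blast)+
next
  case (IfNZ_false r x c2 m t s' c1)
  show ?case
    by (rule exec_IfNZE[OF IfNZ_false.prems]) (use IfNZ_false.hyps(1) IfNZ_false.IH in \<open>simp, blast\<close>)
next
  case (While_true r x c m t1 s' t2 s2)
  show ?case
    by (rule exec_WhileE[OF While_true.prems]) (use While_true.hyps(1) While_true.IH in blast)+
next
  case (While_false r x c m)
  show ?case
    by (rule exec_WhileE[OF While_false.prems]) (use While_false.hyps in simp)+
qed (auto elim: exec_SkipE exec_ConstE exec_AddE exec_SubE exec_MulE exec_LoadE exec_StoreE)

definition initial_config :: "nat list \<Rightarrow> config" where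
  "initial_config xs = (\<lambda>_. 0, \<lambda>i. if i < length xs then xs ! i else 0)"

text \<open>\<open>encodes A xs\<close> means that the word sequence \<open>xs\<close> is an input describing the instance \<open>A\<close>
  (there may be several), and \<open>sz\<close> is the parameter in which time is measured.
  One program decides all instances. Words have \<open>O(log (sz A))\<close> bits: they hold the numbers below
  \<open>(sz A + 2) ^ k\<close> for a constant \<open>k\<close> that belongs to the program. The
  verdict is left in register 0.\<close>

definition decidable_in_time ::
  "'i set \<Rightarrow> ('i \<Rightarrow> nat list \<Rightarrow> bool) \<Rightarrow> ('i \<Rightarrow> nat) \<Rightarrow> ('i \<Rightarrow> bool) \<Rightarrow> (nat \<Rightarrow> real) \<Rightarrow> bool" where
  "decidable_in_time I encodes sz P f \<longleftrightarrow>
     (\<exists>(c :: com) (k :: nat) (T :: nat \<Rightarrow> nat).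
        (\<lambda>n. real (T n)) \<in> O[at_top](f) \<and>
        (\<forall>A \<in> I. \<forall>xs. encodes A xs \<longrightarrow>
           (\<exists>t r m. exec ((sz A + 2) ^ k) c (initial_config xs) t (r, m) \<and>
              t \<le> T (sz A) \<and> r 0 = (if P A then 1 else 0))))"


section \<open>Automata as input\<close>

text \<open>Numbers are given digit by digit, one binary digit per word, preceded by the number of
  digits; the first word of a rational is its sign.\<close>

definition nat_code :: "nat \<Rightarrow> nat list" where
  "nat_code n = length (binary n) # binary n"

definition rat_code :: "rat \<Rightarrow> nat list" where
  "rat_code r = (case quotient_of r of (p, q) \<Rightarrow>
     (if p < 0 then 1 else 0) # nat_code (nat \<bar>p\<bar>) @ nat_code (nat q))"

text \<open>States and letters are numbered from 0 by arbitrary \<open>f\<close> and \<open>g\<close>; initial states and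
  transitions are listed in arbitrary order.\<close>

definition nmda_code :: "('a, 'q) nmda \<Rightarrow> nat list \<Rightarrow> bool" where
  "nmda_code A xs \<longleftrightarrow>
     (\<exists>f g qs es.
        bij_betw f (states A) {..<card (states A)} \<and>
        bij_betw g (alphabet A) {..<card (alphabet A)} \<and>
        distinct qs \<and> set qs = init A \<and>
        distinct es \<and> set es = trans A \<and>
        xs = [card (states A), card (alphabet A), card (init A), card (trans A)]
             @ map f qs
             @ concat (map (\<lambda>(p, a, q). [f p, g a, f q]
                 @ rat_code (weight A (p, a, q)) @ rat_code (discount A (p, a, q))) es))"

end

theory Submission
  imports Defs
begin

text \<open>Fix for every state and letter one outgoing transition. This gives a deterministic run on
  every word, and \<open>A\<close> is tidy iff it is integral and for every word all runs agree with the
  deterministic run on the last discount factor. By completeness it suffices to explore the pairs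
  (state of the deterministic run, state of some run) reachable on a common word, and to compare the
  discount factor of each transition leaving the second state with that of the chosen transition
  for the same letter. There are at most as many pairs and steps as pairs of transitions.
  Comparing discount factors digit by digit at each step would cost a factor \<open>|A|\<close>; a trie
  built beforehand in time linear in the input replaces each discount factor by an identifier that
  fits into one word.\<close>

section \<open>Weakest preconditions for the word RAM\<close>

text \<open>The size counts transitions and the digits of single numbers, so the input may have
  quadratically many words, and one pass over all of it is affordable. The digits of the weights are
  never read. Integrality is settled before anything else because a positive integer is determined
  by the digits of its numerator, so only those enter the trie.

  The search stays quadratic because only transitions leaving the second state are enumerated: a
  pair \<open>(s, p)\<close> costs one round and one more per transition from \<open>p\<close>,
  which sums to \<open>N * N + N * M\<close> over all pairs. Completeness enters twice: it provides
  the chosen transition for every state and letter, and it bounds the numbers of states and letters,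
  which the size does not mention, by the number of transitions.

  No table is ever initialised. Memory beyond the input is 0, and 0 always means absent: no next
  transition, no child, not visited. Overflow is excluded since all table addresses stay below
  \<open>9 * (B * B)\<close>, where \<open>B\<close> is at most quadratic in the size.\<close>

definition wp :: "nat \<Rightarrow> com \<Rightarrow> (nat \<Rightarrow> (nat \<Rightarrow> nat) \<Rightarrow> (nat \<Rightarrow> nat) \<Rightarrow> bool) \<Rightarrow>
    (nat \<Rightarrow> nat) \<Rightarrow> (nat \<Rightarrow> nat) \<Rightarrow> bool" where
  "wp W c Q r m \<longleftrightarrow> (\<exists>t r' m'. exec W c (r, m) t (r', m') \<and> Q t r' m')"

text \<open>The rules are equivalences, so \<open>simp\<close> executes straight-line code
  symbolically and counts its steps. What remains are the overflow conditions, because an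
  overflowing step has no successor.\<close>

lemma wp_simps [simp]:
  "wp W Skip Q r m \<longleftrightarrow> Q 1 r m"
  "wp W (Const x n) Q r m \<longleftrightarrow> n < W \<and> Q 1 (r(x := n)) m"
  "wp W (Add x y z) Q r m \<longleftrightarrow> r y + r z < W \<and> Q 1 (r(x := r y + r z)) m"
  "wp W (Sub x y z) Q r m \<longleftrightarrow> r y - r z < W \<and> Q 1 (r(x := r y - r z)) m"
  "wp W (Mul x y z) Q r m \<longleftrightarrow> r y * r z < W \<and> Q 1 (r(x := r y * r z)) m"
  "wp W (Load x a) Q r m \<longleftrightarrow> m (r a) < W \<and> Q 1 (r(x := m (r a))) m"
  "wp W (Store a x) Q r m \<longleftrightarrow> r x < W \<and> Q 1 r (m(r a := r x))"
  "wp W (Seq c1 c2) Q r m \<longleftrightarrow> wp W c1 (\<lambda>t. wp W c2 (\<lambda>u. Q (t + u))) r m"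
  "wp W (IfNZ x c1 c2) Q r m \<longleftrightarrow>
    (if r x \<noteq> 0 then wp W c1 (\<lambda>t. Q (Suc t)) r m else wp W c2 (\<lambda>t. Q (Suc t)) r m)"
proof -
  show "wp W (Seq c1 c2) Q r m \<longleftrightarrow> wp W c1 (\<lambda>t. wp W c2 (\<lambda>u. Q (t + u))) r m"
    unfolding wp_def by (fastforce elim: exec_SeqE intro: exec.Seq)
  show "wp W (IfNZ x c1 c2) Q r m \<longleftrightarrow>
    (if r x \<noteq> 0 then wp W c1 (\<lambda>t. Q (Suc t)) r m else wp W c2 (\<lambda>t. Q (Suc t)) r m)"
    unfolding wp_def by (auto elim!: exec_IfNZE intro: exec.IfNZ_true exec.IfNZ_false)
qed (auto simp: wp_def intro: exec.intros[unfolded One_nat_def]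
    elim: exec_SkipE exec_ConstE exec_AddE exec_SubE exec_MulE exec_LoadE exec_StoreE)

lemma wp_mono:
  assumes "wp W c P r m" and "\<And>t r' m'. P t r' m' \<Longrightarrow> Q t r' m'"
  shows "wp W c Q r m"
  using assms unfolding wp_def by blast

lemma wp_seqI:
  assumes "wp W c1 P r m" and "\<And>t r' m'. P t r' m' \<Longrightarrow> wp W c2 (\<lambda>u. Q (t + u)) r' m'"
  shows "wp W (Seq c1 c2) Q r m"
  using assms by (auto intro: wp_mono)

text \<open>\<open>\<Phi>\<close> bounds the remaining running time, so it also gives termination.\<close>

lemma wp_while:
  assumes inv: "I r m"
    and step: "\<And>r m. I r m \<Longrightarrow> r x \<noteq> 0 \<Longrightarrow>
      wp W c (\<lambda>t r' m'. I r' m' \<and> Suc t + \<Phi> r' m' \<le> \<Phi> r m) r m"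
    and exit: "\<And>r' m' t. I r' m' \<Longrightarrow> r' x = 0 \<Longrightarrow> t \<le> Suc (\<Phi> r m) \<Longrightarrow> Q t r' m'"
  shows "wp W (While x c) Q r m"
proof -
  have "\<exists>t r' m'. exec W (While x c) (r, m) t (r', m') \<and> I r' m' \<and> r' x = 0 \<and> t \<le> Suc (\<Phi> r m)"
    using inv
  proof (induction "\<Phi> r m" arbitrary: r m rule: less_induct)
    case less
    show ?case
    proof (cases "r x = 0")
      case True
      then show ?thesis
        using less.prems exec.While_false[of r x W c m] by fastforce
    next
      case False
      obtain t1 r1 m1 where 1: "exec W c (r, m) t1 (r1, m1)" "I r1 m1" "Suc t1 + \<Phi> r1 m1 \<le> \<Phi> r m"
        using step[OF less.prems False] unfolding wp_def by blast
      obtain t2 r2 m2 where 2: "exec W (While x c) (r1, m1) t2 (r2, m2)" "I r2 m2" "r2 x = 0"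
        "t2 \<le> Suc (\<Phi> r1 m1)"
        using less.hyps[of r1 m1] 1 by auto
      have "exec W (While x c) (r, m) (Suc (t1 + t2)) (r2, m2)"
        using exec.While_true[OF False 1(1) 2(1)] .
      moreover have "Suc (t1 + t2) \<le> Suc (\<Phi> r m)"
        using 1(3) 2(4) by simp
      ultimately show ?thesis
        using 2 by blast
    qed
  qed
  then show ?thesis
    unfolding wp_def using exit by blast
qed

section \<open>The program\<close>

text \<open>Registers: 0 verdict, 2 the constant 1, 3 number of transitions, 4 number of initial states,
  5 input length, 6 input position, 7 loop counter, \<open>10 + k\<close> base address of table \<open>k\<close>,
  20 transition, 21 its source, 22 its letter, 23 trie node, 25 state of the deterministic run,
  26 and 27 front and back of the queue; the others are temporary.
  Tables: 1 trie, 2 identifier of the discount factor of a transition, 3 the transition of the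
  deterministic run for a state and a letter, 4 previous transition with the same source, 5 last
  transition with a given source, 6 visited pairs, 7 and 8 the queue of pairs.
  A transition is identified with its address in the input, a trie node with the address
  of the digit for which it was created; 0 is the root, and the null pointer.\<close>

abbreviation seq_com (infixr \<open>;;\<close> 60) where "c1 ;; c2 \<equiv> Seq c1 c2"

text \<open>The digit count precedes the digits, so a number of any length is passed over in three
  steps.\<close>

definition skip_number :: com where
  "skip_number = Load 8 6 ;; Add 6 6 8 ;; Add 6 6 2"

text \<open>The 4 covers source, letter, target and the sign of the weight. A denominator in lowest
  terms is positive, hence it is 1 iff it has a single binary digit, and its digit count
  decides.\<close>

definition scan_body :: com where
  "scan_body =
     Const 8 4 ;; Add 6 6 8 ;; skip_number ;; skip_number ;; Add 6 6 2 ;; skip_number ;;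
     Load 8 6 ;; Sub 9 8 2 ;; IfNZ 9 (Const 0 0) Skip ;; skip_number ;; Sub 7 7 2"

text \<open>There is no copy instruction; adding a register set to 0 replaces it. Naming a new node
  by the input position saves an allocation counter.\<close>

definition trie_body :: com where
  "trie_body =
     Load 8 6 ;; Add 9 23 23 ;; Add 9 9 8 ;; Add 9 9 11 ;; Load 23 9 ;;
     IfNZ 23 Skip (Store 9 6 ;; Const 8 0 ;; Add 23 6 8) ;; Add 6 6 2 ;; Sub 10 10 2"

text \<open>A later transition with the same source and letter overwrites the entry of table 3; any
  choice serves as the deterministic run. The old head in table 5 is read before it is replaced,
  since it becomes the successor of the new head.\<close>

definition link_transition :: com where
  "link_transition =
     Const 8 0 ;; Add 20 6 8 ;; Load 21 20 ;; Add 8 20 2 ;; Load 22 8 ;;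
     Mul 8 21 5 ;; Add 8 8 22 ;; Add 8 8 13 ;; Store 8 20 ;;
     Add 8 15 21 ;; Load 9 8 ;; Store 8 20 ;; Add 8 14 20 ;; Store 8 9"

definition index_prepare :: com where
  "index_prepare =
     link_transition ;; Const 8 4 ;; Add 6 6 8 ;; skip_number ;; skip_number ;; Add 6 6 2 ;;
     Load 10 6 ;; Add 6 6 2 ;; Const 23 0"

text \<open>The step by 2 relies on integrality: a denominator 1 occupies two words, its digit count
  and its digit.\<close>

definition index_finish :: com where
  "index_finish = Add 8 12 20 ;; Store 8 23 ;; Const 8 2 ;; Add 6 6 8 ;; Sub 7 7 2"

definition index_body :: com where
  "index_body = index_prepare ;; While 10 trie_body ;; index_finish"

text \<open>The visited table is not consulted: all these pairs have the same first component and
  the initial states are listed without repetition, so no pair comes twice.\<close>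

definition init_body :: com where
  "init_body =
     Load 21 24 ;; Mul 8 25 5 ;; Add 8 8 21 ;; Add 8 8 16 ;; Store 8 2 ;;
     Add 8 17 27 ;; Store 8 25 ;; Add 8 18 27 ;; Store 8 21 ;;
     Add 27 27 2 ;; Add 24 24 2 ;; Sub 7 7 2"

definition pop :: com where
  "pop =
     Sub 8 27 26 ;;
     IfNZ 8
       (Add 8 17 26 ;; Load 25 8 ;; Add 8 18 26 ;; Load 21 8 ;; Add 26 26 2 ;;
        Add 8 15 21 ;; Load 20 8)
       (Const 7 0)"

definition push :: com where
  "push =
     Const 8 2 ;; Add 8 8 10 ;; Load 22 8 ;; Mul 8 22 5 ;; Add 8 8 9 ;; Add 8 8 16 ;; Load 23 8 ;;
     IfNZ 23 Skip
       (Store 8 2 ;; Add 8 17 27 ;; Store 8 22 ;; Add 8 18 27 ;; Store 8 9 ;; Add 27 27 2) ;;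
     Add 8 14 20 ;; Load 20 8"

text \<open>Subtraction truncates at 0, so the sum of the two differences is 0 only for equal
  identifiers. Registers 9 and 10 are left for \<open>push\<close>: the target and the chosen
  transition.\<close>

definition compare :: com where
  "compare =
     Add 8 20 2 ;; Load 22 8 ;; Add 8 8 2 ;; Load 9 8 ;;
     Mul 8 25 5 ;; Add 8 8 22 ;; Add 8 8 13 ;; Load 10 8 ;;
     Add 8 12 10 ;; Load 23 8 ;; Add 8 12 20 ;; Load 24 8 ;;
     Sub 8 23 24 ;; Sub 23 24 23 ;; Add 8 8 23"

text \<open>One flat loop replaces a list traversal nested in a queue loop: each round pops a pair
  or treats one transition, so that a single potential bounds all rounds.\<close>

definition search_body :: com where
  "search_body = IfNZ 20 (compare ;; IfNZ 8 (Const 0 0 ;; Const 7 0) push) pop"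

definition rewind :: com where
  "rewind = Const 8 4 ;; Add 6 8 4 ;; Const 8 3 ;; Load 7 8"

text \<open>The scan has left register 6 at the end of the input; this is how the program learns
  \<open>B\<close>.\<close>

definition layout :: com where
  "layout =
     Const 8 0 ;; Add 5 6 8 ;; Mul 11 6 6 ;; Add 12 11 11 ;; Add 13 12 11 ;; Add 14 13 11 ;;
     Add 15 14 11 ;; Add 16 15 11 ;; Add 17 16 11 ;; Add 18 17 11"

text \<open>The deterministic run starts in the first listed initial state. If there is none,
  address 4 belongs to the first transition and the loop that follows is not entered.\<close>

definition init_setup :: com where
  "init_setup = Const 24 4 ;; Load 25 24 ;; Const 26 0 ;; Const 27 0 ;; Const 8 2 ;; Load 7 8"

definition tidy_integral :: com where
  "tidy_integral =
     layout ;; rewind ;; While 7 index_body ;; init_setup ;; While 7 init_body ;;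
     Const 20 0 ;; Const 7 1 ;; While 7 search_body"

definition tidy_program :: com where
  "tidy_program =
     Const 2 1 ;; Const 8 3 ;; Load 3 8 ;; Const 0 1 ;;
     IfNZ 3
       (Const 8 2 ;; Load 4 8 ;; rewind ;; While 7 scan_body ;; IfNZ 0 tidy_integral Skip)
       Skip"

section \<open>Well-formed inputs\<close>

text \<open>For a transition at address \<open>e\<close>, \<open>cnt e\<close> and \<open>den e\<close> are the addresses of the digit counts of
  numerator and denominator of its discount factor, and the digits of the numerator
  start at \<open>digs e\<close>. \<open>st i\<close> is the address of the \<open>i\<close>-th transition, \<open>B\<close> the length of the input.\<close>

locale word_input =
  fixes inp :: "nat \<Rightarrow> nat" and W B N n :: nat and st :: "nat \<Rightarrow> nat"
  fixes src lab dst after_num cnt dn den digs M nI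
  defines "src e \<equiv> inp e"
    and "lab e \<equiv> inp (e + 1)"
    and "dst e \<equiv> inp (e + 2)"
    and "after_num x \<equiv> x + inp x + 1"
    and "cnt e \<equiv> after_num (after_num (e + 4)) + 1"
    and "dn e \<equiv> inp (cnt e)"
    and "digs e \<equiv> cnt e + 1"
    and "den e \<equiv> after_num (cnt e)"
    and "nI \<equiv> inp 2"
    and "M \<equiv> inp 3"
  assumes W: "10 * (B * B) < W"
    and M_pos: "0 < M" and M_le: "M \<le> n" and N_le: "N \<le> M" and nI_le: "nI \<le> n"
    and st_0: "st 0 = 4 + nI" and st_Suc: "i < M \<Longrightarrow> st (Suc i) = after_num (den (st i))"
    and st_M: "st M = B"
    and inp_less: "inp x < B" and inp_0: "B \<le> x \<Longrightarrow> inp x = 0"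
    and init_less: "i < nI \<Longrightarrow> inp (4 + i) < N"
    and init_inj: "inj_on (\<lambda>i. inp (4 + i)) {..<nI}"
    and src_less: "i < M \<Longrightarrow> src (st i) < N"
    and dst_less: "i < M \<Longrightarrow> dst (st i) < N"
    and digit_less: "i < M \<Longrightarrow> j < dn (st i) \<Longrightarrow> inp (digs (st i) + j) < 2"
    and den_pos: "i < M \<Longrightarrow> 0 < inp (den (st i))"
    and dn_le: "i < M \<Longrightarrow> dn (st i) \<le> n"
    and complete: "s < N \<Longrightarrow> i < M \<Longrightarrow> \<exists>j < M. src (st j) = s \<and> lab (st j) = lab (st i)"
begin

definition integral :: bool where
  "integral \<longleftrightarrow> (\<forall>i < M. inp (den (st i)) = 1)"

lemma after_num_gt: "x < after_num x"
  by (simp add: after_num_def)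

lemma layout_order:
  "e + 4 < after_num (e + 4)" "after_num (e + 4) < after_num (after_num (e + 4))"
  "after_num (after_num (e + 4)) < cnt e" "cnt e < den e" "den e < after_num (den e)"
  by (simp_all add: after_num_gt den_def cnt_def)

lemma den_eq: "den e = digs e + dn e"
  by (simp add: den_def digs_def dn_def after_num_def)

text \<open>Nine words occur besides the digits: source, letter, target, two signs and four digit
  counts.\<close>

lemma st_lt_Suc: "i < M \<Longrightarrow> st i + 9 \<le> st (Suc i)"
  using layout_order[of "st i"] by (simp add: st_Suc)

lemma st_strict: "i < j \<Longrightarrow> j \<le> M \<Longrightarrow> st i + 9 \<le> st j"
proof (induction j)
  case (Suc j)
  then show ?case
    using st_lt_Suc[of j] by (cases "i = j") auto
qed simp

lemma st_ge: "i \<le> M \<Longrightarrow> 4 + nI \<le> st i"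
  using st_strict[of 0 i] st_0 by (cases "i = 0") auto

lemma st_less_iff: "i \<le> M \<Longrightarrow> j \<le> M \<Longrightarrow> st i < st j \<longleftrightarrow> i < j"
  using st_strict[of i j] st_strict[of j i] by (cases i j rule: linorder_cases) auto

lemma st_eq_iff: "i \<le> M \<Longrightarrow> j \<le> M \<Longrightarrow> st i = st j \<longleftrightarrow> i = j"
  using st_strict[of i j] st_strict[of j i] by (cases i j rule: linorder_cases) auto

lemma st_Suc_le: "i < M \<Longrightarrow> after_num (den (st i)) \<le> B"
  using st_Suc[of i] st_strict[of "Suc i" M] st_M
  by (cases "Suc i = M") auto

lemma st_bound: "i < M \<Longrightarrow> st i + 9 \<le> B"
  using st_strict[of i M] st_M by simp

lemma B_ge: "4 \<le> B"
  using st_ge[of M] st_M by simp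

lemma M_le_B: "M \<le> B"
proof -
  have "i \<le> M \<Longrightarrow> i \<le> st i" for i
  proof (induction i)
    case (Suc i)
    then show ?case using st_lt_Suc[of i] by simp
  qed simp
  then show ?thesis using st_M by blast
qed

lemma B_less_W: "9 * B < W"
proof -
  have "4 * B \<le> B * B"
    using B_ge by (rule mult_le_mono1)
  then show ?thesis using W by linarith
qed

lemma wp_skip_number:
  assumes "r 2 = 1" "m (r 6) = inp (r 6)" "after_num (r 6) \<le> B"
  shows "wp W skip_number Q r m \<longleftrightarrow> Q 3 (r(8 := inp (r 6), 6 := after_num (r 6))) m"
  using assms B_less_W inp_less[of "r 6"]
  by (simp add: skip_number_def after_num_def numeral_3_eq_3)

section \<open>The integrality scan\<close>

definition scan_inv :: "(nat \<Rightarrow> nat) \<Rightarrow> nat \<Rightarrow> bool" where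
  "scan_inv r i \<longleftrightarrow> i \<le> M \<and> r 2 = 1 \<and> r 6 = st i \<and> r 7 = M - i \<and>
     r 0 = (if \<forall>j < i. inp (den (st j)) = 1 then 1 else 0)"

lemma scan:
  assumes "r 2 = 1" "r 0 = 1" "r 6 = 4 + nI" "r 7 = M"
  shows "wp W (While 7 scan_body)
    (\<lambda>t r' m'. m' = inp \<and> r' 2 = 1 \<and> r' 6 = B \<and> r' 4 = r 4 \<and>
       r' 0 = (if integral then 1 else 0) \<and> t \<le> Suc (30 * M)) r inp"
proof (rule wp_while[where \<Phi> = "\<lambda>r m. 30 * r 7" and
      I = "\<lambda>r' m'. m' = inp \<and> r' 4 = r 4 \<and> scan_inv r' (M - r' 7)"], goal_cases)
  case 1
  then show ?case
    using assms st_0 by (simp add: scan_inv_def)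
next
  case (2 r' m')
  define i where "i = M - r' 7"
  define e where "e = st i"
  have [simp]: "m' = inp" "r' 4 = r 4"
    using 2 by auto
  have i: "i < M" "r' 2 = 1" "r' 6 = e" "r' 7 = M - i"
    "r' 0 = (if \<forall>j < i. inp (den (st j)) = 1 then 1 else 0)"
    using 2 by (auto simp: scan_inv_def i_def e_def)
  note b = layout_order[of e] st_Suc_le[OF i(1), folded e_def]
  have [simp]: "inp x < W" "inp x - 1 < W" for x
    using inp_less[of x] B_less_W by simp_all
  have den: "0 < inp (den e)"
    using den_pos i(1) by (simp add: e_def)
  have [simp]: "after_num (after_num (e + 4)) + 1 = cnt e" "after_num (cnt e) = den e"
    by (simp_all add: den_def cnt_def)
  have inv: "scan_inv r'' (i + 1)" if "r'' 2 = 1" "r'' 6 = after_num (den e)"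
    "r'' 7 = M - (i + 1)" "r'' 0 = (if inp (den e) = 1 then r' 0 else 0)" for r''
    using that i st_Suc[OF i(1)] by (auto simp: scan_inv_def e_def less_Suc_eq)
  have [simp]: "M - (M - (i + 1)) = i + 1"
    using i by simp
  have "M - (i + 1) < W" "30 * (M - (i + 1)) + 30 = 30 * (M - i)"
    using i M_le_B B_less_W by simp_all
  then show ?case
    using b B_less_W i den
    by (simp add: scan_body_def wp_skip_number inv del: One_nat_def)
next
  case (3 r' m' t)
  then show ?case
    using st_M by (simp add: integral_def assms scan_inv_def)
qed


section \<open>Tables and the trie\<close>

text \<open>Tables are spaced \<open>B * B\<close> apart, which leaves room for an entry per pair of states;
  table 0 is the input.\<close>

definition tab :: "nat \<Rightarrow> nat \<Rightarrow> nat" where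
  "tab k x = k * (B * B) + x"

lemma B_le_square: "4 * B \<le> B * B"
  using B_ge by (rule mult_le_mono1)

lemma tab_add [simp]: "tab k 0 + x = tab k x" "x + tab k 0 = tab k x"
  by (simp_all add: tab_def)

lemma tab_less_W: "x < B * B \<Longrightarrow> k \<le> 8 \<Longrightarrow> tab k x < W"
  using W mult_le_mono1[of k 8 "B * B"] unfolding tab_def by linarith

lemma tab_eq_iff: "x < B * B \<Longrightarrow> y < B * B \<Longrightarrow> tab k x = tab l y \<longleftrightarrow> k = l \<and> x = y"
proof (cases k l rule: linorder_cases)
  case less
  assume "x < B * B" "y < B * B"
  moreover have "Suc k * (B * B) \<le> l * (B * B)"
    using less by (intro mult_le_mono1) simp
  ultimately show ?thesis using less by (simp add: tab_def)
next
  case greater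
  assume "x < B * B" "y < B * B"
  moreover have "Suc l * (B * B) \<le> k * (B * B)"
    using greater by (intro mult_le_mono1) simp
  ultimately show ?thesis using greater by (simp add: tab_def)
qed (simp add: tab_def)

lemma less_tab: "x < B \<Longrightarrow> 0 < k \<Longrightarrow> x < tab k y"
proof -
  assume "x < B" "0 < k"
  moreover have "1 * (B * B) \<le> k * (B * B)"
    using \<open>0 < k\<close> by (intro mult_le_mono1) simp
  ultimately show ?thesis
    using B_le_square unfolding tab_def by linarith
qed

lemma pair_index_less: "x < B \<Longrightarrow> y < B \<Longrightarrow> x * B + y < B * B"
  using mult_le_mono1[of "Suc x" B B] by simp

lemma pair_index_eq: "y < B \<Longrightarrow> y' < B \<Longrightarrow> x * B + y = x' * B + y' \<longleftrightarrow> x = x' \<and> y = y'"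
proof -
  assume y: "y < B" "y' < B"
  have "x * B + y = x' * B + y' \<Longrightarrow> x = x'"
    using y by (metis div_mult_self3 div_less add.right_neutral less_zeroE)
  then show ?thesis by auto
qed


definition bits :: "nat \<Rightarrow> nat list" where
  "bits e = map inp [digs e..<den e]"

text \<open>\<open>V\<close> is the set of nodes and \<open>\<phi> v\<close> the digit string leading to node \<open>v\<close>, whose child
  for digit \<open>b\<close> is entry \<open>2 v + b\<close>.\<close>

definition trie :: "(nat \<Rightarrow> nat) \<Rightarrow> (nat \<Rightarrow> nat list) \<Rightarrow> nat set \<Rightarrow> bool" where
  "trie m \<phi> V \<longleftrightarrow> 0 \<in> V \<and> \<phi> 0 = [] \<and> inj_on \<phi> V \<and> V \<subseteq> {..<B} \<and>
     (\<forall>v \<in> V. \<forall>b < 2. m (tab 1 (v + v + b)) = 0 \<or>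
        m (tab 1 (v + v + b)) \<in> V \<and> \<phi> (m (tab 1 (v + v + b))) = \<phi> v @ [b]) \<and>
     (\<forall>w \<in> V. w \<noteq> 0 \<longrightarrow> (\<exists>v \<in> V. \<exists>b < 2. m (tab 1 (v + v + b)) = w)) \<and>
     (\<forall>v < B. v \<notin> V \<longrightarrow> (\<forall>b < 2. m (tab 1 (v + v + b)) = 0))"

lemma child_index_less: "v < B \<Longrightarrow> b < 2 \<Longrightarrow> v + v + b < B * B"
  using B_le_square by linarith

lemma child_index_eq:
  "b < 2 \<Longrightarrow> b' < 2 \<Longrightarrow> v + v + b = v' + v' + b' \<longleftrightarrow> v = v' \<and> (b::nat) = b'"
  by presburger

lemma trie_child:
  "trie m \<phi> V \<Longrightarrow> v \<in> V \<Longrightarrow> b < 2 \<Longrightarrow> m (tab 1 (v + v + b)) = 0 \<or>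
     m (tab 1 (v + v + b)) \<in> V \<and> \<phi> (m (tab 1 (v + v + b))) = \<phi> v @ [b]"
  by (simp add: trie_def)

lemma trie_cong:
  assumes "trie m \<phi> V" "\<And>x. x < B * B \<Longrightarrow> m' (tab 1 x) = m (tab 1 x)"
  shows "trie m' \<phi> V"
proof -
  have *: "m' (tab 1 (v + v + b)) = m (tab 1 (v + v + b))" if "v < B" "b < 2" for v b
    using assms(2) child_index_less that by blast
  have V: "V \<subseteq> {..<B}"
    using assms(1) by (simp add: trie_def)
  have "(\<exists>v \<in> V. \<exists>b < 2. m' (tab 1 (v + v + b)) = w) \<longleftrightarrow>
      (\<exists>v \<in> V. \<exists>b < 2. m (tab 1 (v + v + b)) = w)" for w
    using V * by (intro bex_cong ex_cong) auto
  moreover have "m' (tab 1 (v + v + b)) = m (tab 1 (v + v + b))" if "v \<in> V" "b < 2" for v b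
    using V * that by auto
  ultimately show ?thesis
    using assms(1) * unfolding trie_def by simp
qed

text \<open>The labelling stays injective: a node already labelled \<open>\<phi> v @ [b]\<close> is
  not the root, so it has an incoming edge, and injectivity identifies that edge as the one from
  \<open>v\<close> for \<open>b\<close>, whose entry is 0.\<close>

lemma trie_insert:
  assumes t: "trie m \<phi> V" and v: "v \<in> V" "b < 2" and p: "p \<notin> V" "0 < p" "p < B"
    and free: "m (tab 1 (v + v + b)) = 0"
  shows "trie (m(tab 1 (v + v + b) := p)) (\<phi>(p := \<phi> v @ [b])) (insert p V)"
proof -
  define m2 \<phi>2 where "m2 = m(tab 1 (v + v + b) := p)" and "\<phi>2 = \<phi>(p := \<phi> v @ [b])"
  have V: "V \<subseteq> {..<B}" "0 \<in> V" "\<phi> 0 = []" "inj_on \<phi> V"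
    and child: "\<And>u c. u \<in> V \<Longrightarrow> c < 2 \<Longrightarrow> m (tab 1 (u + u + c)) = 0 \<or>
        m (tab 1 (u + u + c)) \<in> V \<and> \<phi> (m (tab 1 (u + u + c))) = \<phi> u @ [c]"
    and parent: "\<And>w. w \<in> V \<Longrightarrow> w \<noteq> 0 \<Longrightarrow> \<exists>v \<in> V. \<exists>b < 2. m (tab 1 (v + v + b)) = w"
    and fresh: "\<And>u c. u < B \<Longrightarrow> u \<notin> V \<Longrightarrow> c < 2 \<Longrightarrow> m (tab 1 (u + u + c)) = 0"
    using t unfolding trie_def by auto
  have vB: "v < B" using V v by auto
  have m: "m2 (tab 1 (u + u + c)) = (if u = v \<and> c = b then p else m (tab 1 (u + u + c)))"
    if "u < B" "c < 2" for u c
    unfolding m2_def fun_upd_apply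
    using tab_eq_iff[OF child_index_less[OF that] child_index_less[OF vB v(2)]]
      child_index_eq[OF that(2) v(2)] by simp
  have new: "\<phi> w \<noteq> \<phi> v @ [b]" if w: "w \<in> V" for w
  proof
    assume eq: "\<phi> w = \<phi> v @ [b]"
    then have "w \<noteq> 0" using V by (intro notI) simp
    then obtain u c where u: "u \<in> V" "c < 2" "m (tab 1 (u + u + c)) = w"
      using parent[OF w \<open>w \<noteq> 0\<close>] by blast
    then have "\<phi> w = \<phi> u @ [c]"
      using child \<open>w \<noteq> 0\<close> by metis
    then have "u = v" "c = b"
      using eq u v V(4) by (auto dest: inj_onD)
    then show False using u free \<open>w \<noteq> 0\<close> by simp
  qed
  have p2: "\<phi>2 p = \<phi> v @ [b]" "\<And>u. u \<in> V \<Longrightarrow> \<phi>2 u = \<phi> u"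
    using p(1) by (auto simp: \<phi>2_def)
  have 1: "inj_on \<phi>2 (insert p V)"
  proof -
    have "inj_on \<phi>2 V" using V(4) p2 by (simp cong: inj_on_cong)
    moreover have "\<phi>2 p \<notin> \<phi>2 ` V" using new p2 by (auto dest: sym)
    ultimately show ?thesis by (auto simp: inj_on_insert)
  qed
  have 2: "m2 (tab 1 (u + u + c)) = 0 \<or>
      m2 (tab 1 (u + u + c)) \<in> insert p V \<and> \<phi>2 (m2 (tab 1 (u + u + c))) = \<phi>2 u @ [c]"
    if u: "u \<in> insert p V" and c: "c < 2" for u c
  proof -
    have uB: "u < B" using u V p by auto
    show ?thesis
    proof (cases "u = p")
      case True
      then show ?thesis using m[OF uB c] fresh[OF uB _ c] p v by auto
    next
      case False
      then show ?thesis
        using m[OF uB c] child[OF _ c, of u] p2 u v by auto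
    qed
  qed
  have 3: "\<exists>u \<in> insert p V. \<exists>c < 2. m2 (tab 1 (u + u + c)) = w"
    if w: "w \<in> insert p V" "w \<noteq> 0" for w
  proof (cases "w = p")
    case True
    then have "m2 (tab 1 (v + v + b)) = w" using m[OF vB v(2)] by simp
    then show ?thesis using v by blast
  next
    case False
    then obtain u c where u: "u \<in> V" "c < 2" "m (tab 1 (u + u + c)) = w"
      using parent w by blast
    moreover have "\<not> (u = v \<and> c = b)" using u free w by auto
    ultimately have "m2 (tab 1 (u + u + c)) = w" using m[of u c] V by auto
    then show ?thesis using u by blast
  qed
  have 4: "m2 (tab 1 (u + u + c)) = 0" if "u < B" "u \<notin> insert p V" "c < 2" for u c
    using m[of u c] fresh[of u c] that v by auto
  have 5: "0 \<in> insert p V" "\<phi>2 0 = []" "insert p V \<subseteq> {..<B}"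
    using V p p2 by auto
  show ?thesis
    unfolding trie_def m2_def[symmetric] \<phi>2_def[symmetric]
    by (intro conjI ballI allI impI 1 2 3 4 5)
qed

definition bases :: "(nat \<Rightarrow> nat) \<Rightarrow> bool" where
  "bases r \<longleftrightarrow> r 2 = 1 \<and> r 5 = B \<and> r 11 = tab 1 0 \<and> r 12 = tab 2 0 \<and> r 13 = tab 3 0 \<and>
     r 14 = tab 4 0 \<and> r 15 = tab 5 0 \<and> r 16 = tab 6 0 \<and> r 17 = tab 7 0 \<and> r 18 = tab 8 0"

lemma bases_upd [simp]:
  "k \<noteq> 2 \<Longrightarrow> k \<noteq> 5 \<Longrightarrow> k < 11 \<or> 18 < k \<Longrightarrow> bases (r(k := v)) = bases r"
  unfolding bases_def by auto

text \<open>Tables hold input addresses, states and the mark 1, all below \<open>B\<close>. Bounding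
  every cell means that no load can overflow, whatever its address.\<close>

definition memory_ok :: "(nat \<Rightarrow> nat) \<Rightarrow> bool" where
  "memory_ok m \<longleftrightarrow> (\<forall>x < B. m x = inp x) \<and> (\<forall>x. m x < B)"

lemma memory_ok_upd: "memory_ok m \<Longrightarrow> v < B \<Longrightarrow> 0 < k \<Longrightarrow> memory_ok (m(tab k x := v))"
  unfolding memory_ok_def using less_tab[of _ k x] by auto

lemma memory_ok_inp: "memory_ok m \<Longrightarrow> x < B \<Longrightarrow> m x = inp x"
  by (simp add: memory_ok_def)

lemma memory_ok_less: "memory_ok m \<Longrightarrow> m x < B" "memory_ok m \<Longrightarrow> m x < W"
  using B_less_W by (auto simp: memory_ok_def intro: less_le_trans)

text \<open>The trie may only grow from \<open>V0\<close>, with old labels kept, so identifiers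
  given to earlier transitions stay valid. Nodes below \<open>p\<close> make the position
  \<open>p\<close> a fresh name.\<close>

definition trie_state where
  "trie_state \<phi>0 V0 m p v s \<longleftrightarrow> (\<exists>\<phi> V. trie m \<phi> V \<and> V0 \<subseteq> V \<and> V \<subseteq> {..<p} \<and>
     (\<forall>u \<in> V0. \<phi> u = \<phi>0 u) \<and> v \<in> V \<and> \<phi> v = s)"

lemma trie_stateI:
  "trie m \<phi> V \<Longrightarrow> V0 \<subseteq> V \<Longrightarrow> V \<subseteq> {..<p} \<Longrightarrow> (\<And>u. u \<in> V0 \<Longrightarrow> \<phi> u = \<phi>0 u) \<Longrightarrow>
    v \<in> V \<Longrightarrow> \<phi> v = s \<Longrightarrow> trie_state \<phi>0 V0 m p v s"
  unfolding trie_state_def by blast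

definition walk_inv where
  "walk_inv e \<phi>0 V0 m0 r m \<longleftrightarrow> bases r \<and> memory_ok m \<and> digs e \<le> r 6 \<and> r 6 + r 10 = den e \<and>
     (\<forall>k x. k \<noteq> 1 \<longrightarrow> x < B * B \<longrightarrow> m (tab k x) = m0 (tab k x)) \<and>
     trie_state \<phi>0 V0 m (r 6) (r 23) (map inp [digs e..<r 6])"

lemma walk:
  assumes i: "i < M" and e: "e = st i"
    and r: "bases r" "r 6 = digs e" "r 10 = dn e" "r 23 = 0"
    and m: "memory_ok m" "trie m \<phi>0 V0" "V0 \<subseteq> {..<e}"
  shows "wp W (While 10 trie_body)
    (\<lambda>t r' m'. walk_inv e \<phi>0 V0 m r' m' \<and> r' 10 = 0 \<and> r' 20 = r 20 \<and> r' 7 = r 7 \<and> r' 0 = r 0 \<and>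
       t \<le> Suc (20 * dn e)) r m"
proof (rule wp_while[where \<Phi> = "\<lambda>r m. 20 * r 10" and
      I = "\<lambda>r' m'. walk_inv e \<phi>0 V0 m r' m' \<and> r' 20 = r 20 \<and> r' 7 = r 7 \<and> r' 0 = r 0"], goal_cases)
  case 1
  have "trie_state \<phi>0 V0 m (r 6) (r 23) (map inp [digs e..<r 6])"
    using m r layout_order[of e] by (intro trie_stateI[of m \<phi>0 V0]) (auto simp: trie_def digs_def)
  then show ?case
    using r m(1) by (simp add: walk_inv_def den_eq)
next
  case (2 r' m')
  define p v where "p = r' 6" and "v = r' 23"
  define b where "b = inp p"
  define w where "w = m' (tab 1 (v + v + b))"
  have inv: "bases r'" "memory_ok m'" "digs e \<le> p" "p + r' 10 = den e"
    "\<And>k x. k \<noteq> 1 \<Longrightarrow> x < B * B \<Longrightarrow> m' (tab k x) = m (tab k x)"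
    using 2 by (auto simp: walk_inv_def p_def)
  obtain \<phi> V where t: "trie m' \<phi> V" "V0 \<subseteq> V" "V \<subseteq> {..<p}" "\<forall>v \<in> V0. \<phi> v = \<phi>0 v"
    "v \<in> V" "\<phi> v = map inp [digs e..<p]"
    using 2 unfolding walk_inv_def trie_state_def p_def v_def by blast
  have "den e < B"
    using layout_order[of e] st_Suc_le[OF i] e by simp
  then have pB: "p < B" "p < den e" "0 < p"
    using inv 2 t by auto
  have b: "b < 2"
    using digit_less[OF i, of "p - digs e"] inv(3) pB(2) unfolding den_eq b_def e by simp
  have v: "v < B" using t pB by auto
  have [simp]: "m' x < W" "m' p = b" for x
    using inv(2) pB memory_ok_less memory_ok_inp by (auto simp: b_def)
  have x: "v + v + b < B * B" "tab 1 (v + v + b) < W"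
    using v b child_index_less tab_less_W by auto
  have step: "walk_inv e \<phi>0 V0 m r'' m''"
    if r'': "bases r''" "r'' 6 = p + 1" "r'' 10 = r' 10 - 1"
      and m'': "m'' = (if w = 0 then m'(tab 1 (v + v + b) := p) else m')"
      and v'': "r'' 23 = (if w = 0 then p else w)" for r'' m''
  proof -
    have ok: "memory_ok m''" using inv(2) pB m'' by (simp add: memory_ok_upd)
    have fr: "m'' (tab k y) = m (tab k y)" if "k \<noteq> 1" "y < B * B" for k y
      using inv(5) that x m'' by (auto simp: tab_eq_iff)
    have "trie_state \<phi>0 V0 m'' (p + 1) (r'' 23) (map inp [digs e..<p + 1])"
    \<comment> \<open>The label of a child is nonempty, so the root is nobody's child and an entry 0
      can only mean that the child is missing.\<close>
    proof (cases "w = 0")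
      case True
      have "p \<notin> V" using t by auto
      then have tr: "trie m'' (\<phi>(p := \<phi> v @ [b])) (insert p V)"
        using trie_insert[OF t(1) t(5) b] pB True m'' by (simp add: w_def)
      show ?thesis
      proof (rule trie_stateI[OF tr])
        show "V0 \<subseteq> insert p V" using t(2) by blast
        show "insert p V \<subseteq> {..<p + 1}" using t(3) by auto
        show "(\<phi>(p := \<phi> v @ [b])) u = \<phi>0 u" if "u \<in> V0" for u
          using that t(2,4) \<open>p \<notin> V\<close> by auto
        show "r'' 23 \<in> insert p V" using v'' True by simp
        show "(\<phi>(p := \<phi> v @ [b])) (r'' 23) = map inp [digs e..<p + 1]"
          using v'' True t(6) inv(3) by (simp add: b_def)
      qed
    next
      case False
      then have w: "w \<in> V" "\<phi> w = \<phi> v @ [b]"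
        using trie_child[OF t(1,5) b] False by (simp_all add: w_def)
      have tr: "trie m'' \<phi> V"
        using False m'' t by simp
      show ?thesis
      proof (rule trie_stateI[OF tr])
        show "V0 \<subseteq> V" by (rule t(2))
        show "V \<subseteq> {..<p + 1}" using t(3) by auto
        show "\<phi> u = \<phi>0 u" if "u \<in> V0" for u
          using that t(4) by blast
        show "r'' 23 \<in> V" using v'' False w by simp
        show "\<phi> (r'' 23) = map inp [digs e..<p + 1]"
          using v'' False w t(6) inv(3) by (simp add: b_def)
      qed
    qed
    then show ?thesis
      unfolding walk_inv_def using r'' ok fr inv pB 2(2) by (simp only: r''(2)) auto
  qed
  have r: "r' 2 = 1" "r' 11 = tab 1 0" "r' 6 = p" "r' 23 = v"
    using inv(1) by (auto simp: bases_def p_def v_def)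
  have bounds: "w < W" "b < W" "v + v < W" "v + v + b < W" "p + 1 < W" "r' 10 - 1 < W" "p < W" "0 < W"
    using B_less_W v b pB \<open>den e < B\<close> inv(4) memory_ok_less(2)[OF inv(2)]
    unfolding w_def by (simp_all del: One_nat_def)
  have r7: "r' 20 = r 20" "r' 7 = r 7" "r' 0 = r 0" "20 * (r' 10 - 1) + 20 = 20 * r' 10"
    using 2 by simp_all
  show ?case
  proof (cases "w = 0")
    case True
    then show ?thesis
      using 2(2) r r7 x bounds inv(1) step[OF _ _ _ if_P[OF True, symmetric]]
      by (simp add: trie_body_def w_def[symmetric] del: One_nat_def)
  next
    case False
    then show ?thesis
      using 2(2) r r7 x bounds inv(1) step[OF _ _ _ if_not_P[OF False, symmetric]]
      by (simp add: trie_body_def w_def[symmetric] del: One_nat_def)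
  qed
next
  case (3 r' m' t)
  then show ?case
    using r by simp
qed


section \<open>Indexing the transitions\<close>

text \<open>The transitions with a common source form a list with decreasing addresses, so what
  is left of it from a transition on is determined by an upper bound on the address.\<close>

definition prev :: "nat \<Rightarrow> nat \<Rightarrow> nat" where
  "prev p x = Max (insert 0 (st ` {j. j < M \<and> src (st j) = p \<and> st j < x}))"

lemma prev_st_0: "prev p (st 0) = 0"
proof -
  have *: "{j. j < M \<and> src (st j) = p \<and> st j < st 0} = {}"
    using st_less_iff[of _ 0] by auto
  show ?thesis unfolding prev_def * by simp
qed

lemma prev_Suc:
  assumes "i < M"
  shows "prev p (st (Suc i)) = (if src (st i) = p then st i else prev p (st i))"
proof -
  let ?S = "\<lambda>i. {j. j < M \<and> src (st j) = p \<and> st j < st i}"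
  have *: "?S (Suc i) = (if src (st i) = p then insert i (?S i) else ?S i)"
    using assms by (auto simp: st_less_iff less_Suc_eq)
  show ?thesis
  proof (cases "src (st i) = p")
    case True
    have "Max (insert 0 (insert (st i) (st ` ?S i))) = st i"
      by (rule Max_eqI) auto
    then show ?thesis unfolding prev_def * using True by simp
  qed (simp add: prev_def *)
qed

definition link :: "nat \<Rightarrow> (nat \<Rightarrow> nat) \<Rightarrow> nat \<Rightarrow> nat" where
  "link e m = m(tab 3 (src e * B + lab e) := e, tab 5 (src e) := e, tab 4 e := m (tab 5 (src e)))"

lemma N_le_B: "N \<le> B"
  using N_le M_le_B by simp

lemma B_le_sq: "x < B \<Longrightarrow> x < B * B"
  using B_le_square by linarith

lemma trans_facts:
  assumes "i < M" "e = st i"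
  shows "src e < N" "src e < B" "src e < B * B" "lab e < B" "dst e < N" "e < B" "e < B * B"
    "src e * B + lab e < B * B" "e + 9 \<le> B"
  using assms src_less[of i] dst_less[of i] inp_less[of "e + 1"] st_bound[of i] N_le_B
    B_le_sq[of "src e"] B_le_sq[of e] pair_index_less[of "src e" "lab e"]
  by (auto simp: lab_def)

lemma link_tab:
  assumes "i < M" "e = st i" "x < B * B"
  shows "link e m (tab k x) =
    (if k = 3 \<and> x = src e * B + lab e then e else if k = 5 \<and> x = src e then e
     else if k = 4 \<and> x = e then m (tab 5 (src e)) else m (tab k x))"
  using trans_facts[OF assms(1,2)] assms(3) by (simp add: link_def tab_eq_iff)

lemma memory_ok_link: "i < M \<Longrightarrow> e = st i \<Longrightarrow> memory_ok m \<Longrightarrow> memory_ok (link e m)"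
  unfolding link_def using trans_facts[of i e] memory_ok_less(1)
  by (intro memory_ok_upd) auto

lemma wp_link_transition:
  assumes i: "i < M" "e = st i" and r: "bases r" "r 6 = e" and m: "memory_ok m"
  shows "wp W link_transition Q r m \<longleftrightarrow>
    Q 14 (r(20 := e, 21 := src e, 22 := lab e, 9 := m (tab 5 (src e)), 8 := tab 4 e)) (link e m)"
proof -
  note f = trans_facts[OF i]
  have m': "m e = src e" "m (e + 1) = lab e" "\<And>x. m x < W"
    using memory_ok_inp[OF m] memory_ok_less[OF m] f by (auto simp: src_def lab_def)
  have t: "tab 5 (src e) \<noteq> tab 3 (src e * B + lab e)"
    using f by (simp add: tab_eq_iff)
  have b: "tab 3 (src e * B + lab e) < W" "tab 4 e < W" "tab 5 (src e) < W"
    using f by (auto intro: tab_less_W)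
  have b': "src e * B < W" "src e * B + lab e < W" "e < W" "e + 1 < W" "0 < W" "src e < W" "lab e < W"
    using f W B_less_W by linarith+
  show ?thesis
    using r b b' m' t unfolding bases_def
    by (simp add: link_transition_def link_def del: One_nat_def)
qed

lemma wp_index_prepare:
  assumes i: "i < M" "e = st i" and r: "bases r" "r 6 = e" and m: "memory_ok m"
  shows "wp W index_prepare (\<lambda>t r' m'. t = 26 \<and> m' = link e m \<and> bases r' \<and> r' 6 = digs e \<and>
    r' 10 = dn e \<and> r' 23 = 0 \<and> r' 20 = e \<and> r' 7 = r 7 \<and> r' 0 = r 0) r m"
proof -
  note f = trans_facts[OF i]
  note ok = memory_ok_link[OF i m]
  have m': "link e m x < W" for x
    by (rule memory_ok_less[OF ok])
  note l = memory_ok_inp[OF ok]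
  note b = layout_order[of e] st_Suc_le[OF i(1), folded i(2)] B_less_W
  have [simp]: "after_num (after_num (e + 4)) + 1 = cnt e" "cnt e + 1 = digs e" "inp (cnt e) = dn e"
    by (simp_all add: cnt_def digs_def dn_def)
  have "dn e < B" "digs e \<le> B"
    using inp_less[of "cnt e"] b den_eq[of e] by simp_all
  then have "dn e < W" "digs e < W"
    using B_less_W B_ge by linarith+
  moreover have "r 2 = 1" using r by (simp add: bases_def)
  ultimately show ?thesis
    using r b l m' by (simp add: index_prepare_def wp_link_transition[OF i _ _ m] wp_skip_number
        del: One_nat_def)
qed


text \<open>Which of the transitions with the same source and letter is stored is left open, so
  overwriting an entry preserves the property.\<close>

definition det_ok :: "(nat \<Rightarrow> nat) \<Rightarrow> nat \<Rightarrow> bool" where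
  "det_ok m i \<longleftrightarrow> (\<forall>j < i. \<exists>k < i. m (tab 3 (src (st j) * B + lab (st j))) = st k \<and>
     src (st k) = src (st j) \<and> lab (st k) = lab (st j))"

definition lists_ok :: "(nat \<Rightarrow> nat) \<Rightarrow> nat \<Rightarrow> bool" where
  "lists_ok m i \<longleftrightarrow> (\<forall>p < N. m (tab 5 p) = prev p (st i)) \<and>
     (\<forall>j < i. m (tab 4 (st j)) = prev (src (st j)) (st j))"

text \<open>Since \<phi> is injective on the nodes, labelling identifiers by digit strings makes two
  of them equal exactly when the digit strings are equal.\<close>

definition ids_ok :: "(nat \<Rightarrow> nat) \<Rightarrow> nat \<Rightarrow> bool" where
  "ids_ok m i \<longleftrightarrow> (\<exists>\<phi> V. trie m \<phi> V \<and> V \<subseteq> {..<st i} \<and>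
     (\<forall>j < i. m (tab 2 (st j)) \<in> V \<and> \<phi> (m (tab 2 (st j))) = bits (st j)))"

definition clean :: "(nat \<Rightarrow> nat) \<Rightarrow> bool" where
  "clean m \<longleftrightarrow> (\<forall>k x. 6 \<le> k \<longrightarrow> x < B * B \<longrightarrow> m (tab k x) = 0)"

definition index_ok :: "(nat \<Rightarrow> nat) \<Rightarrow> nat \<Rightarrow> bool" where
  "index_ok m i \<longleftrightarrow> memory_ok m \<and> det_ok m i \<and> lists_ok m i \<and> ids_ok m i \<and> clean m"

lemma det_ok_Suc:
  assumes "i < M" "det_ok m i"
    and upd: "\<And>x. x < B * B \<Longrightarrow> m' (tab 3 x) = link (st i) m (tab 3 x)"
  shows "det_ok m' (Suc i)"
  unfolding det_ok_def
proof (intro allI impI)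
  fix j assume j: "j < Suc i"
  have fj: "src (st j) < B" "lab (st j) < B" "src (st j) * B + lab (st j) < B * B"
    and fi: "src (st i) < B" "lab (st i) < B"
    using j assms(1) trans_facts[of j "st j"] trans_facts[of i "st i"] by auto
  have eq: "m' (tab 3 (src (st j) * B + lab (st j))) =
      (if src (st j) = src (st i) \<and> lab (st j) = lab (st i) then st i
       else m (tab 3 (src (st j) * B + lab (st j))))"
    using upd[OF fj(3)] link_tab[OF assms(1) refl fj(3)] pair_index_eq[OF fj(2) fi(2)] by simp
  show "\<exists>k < Suc i. m' (tab 3 (src (st j) * B + lab (st j))) = st k \<and>
     src (st k) = src (st j) \<and> lab (st k) = lab (st j)"
  proof (cases "src (st j) = src (st i) \<and> lab (st j) = lab (st i)")
    case True
    then show ?thesis using eq by (intro exI[of _ i]) simp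
  next
    case False
    then have "j < i" using j by (auto simp: less_Suc_eq)
    then obtain k where "k < i" "m (tab 3 (src (st j) * B + lab (st j))) = st k"
      "src (st k) = src (st j)" "lab (st k) = lab (st j)"
      using assms(2) unfolding det_ok_def by blast
    then show ?thesis using eq False by (intro exI[of _ k]) auto
  qed
qed

lemma lists_ok_Suc:
  assumes "i < M" "lists_ok m i"
    and upd: "\<And>k x. k = 4 \<or> k = 5 \<Longrightarrow> x < B * B \<Longrightarrow> m' (tab k x) = link (st i) m (tab k x)"
  shows "lists_ok m' (Suc i)"
  unfolding lists_ok_def
proof (intro conjI allI impI)
  fix p assume p: "p < N"
  then have "p < B * B" using N_le_B B_le_sq by auto
  then show "m' (tab 5 p) = prev p (st (Suc i))"
    using upd link_tab[OF assms(1) refl] assms(2) p prev_Suc[OF assms(1)]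
    by (auto simp: lists_ok_def)
next
  fix j assume j: "j < Suc i"
  have f: "st j < B * B" "src (st i) < N"
    using j assms(1) trans_facts[of j "st j"] trans_facts[of i "st i"] by auto
  have "st j = st i \<longleftrightarrow> j = i" using j assms(1) by (simp add: st_eq_iff)
  then show "m' (tab 4 (st j)) = prev (src (st j)) (st j)"
    using upd[of 4 "st j"] link_tab[OF assms(1) refl, of "st j"] assms(2) j f
    by (auto simp: lists_ok_def less_Suc_eq)
qed

lemma ids_ok_Suc:
  assumes i: "i < M" and ids: "\<forall>j < i. m (tab 2 (st j)) \<in> V0 \<and> \<phi>0 (m (tab 2 (st j))) = bits (st j)"
    and ts: "trie_state \<phi>0 V0 m' (den (st i)) v (bits (st i))"
    and upd: "\<And>x. x < B * B \<Longrightarrow> m' (tab 2 x) = m (tab 2 x)"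
  shows "ids_ok (m'(tab 2 (st i) := v)) (Suc i)"
proof -
  obtain \<phi> V where t: "trie m' \<phi> V" "V0 \<subseteq> V" "V \<subseteq> {..<den (st i)}" "\<And>u. u \<in> V0 \<Longrightarrow> \<phi> u = \<phi>0 u"
    "v \<in> V" "\<phi> v = bits (st i)"
    using ts unfolding trie_state_def by blast
  let ?m = "m'(tab 2 (st i) := v)"
  have fi: "st i < B * B" using trans_facts[OF i refl] by simp
  have "trie ?m \<phi> V"
    by (rule trie_cong[OF t(1)]) (use fi in \<open>simp add: tab_eq_iff\<close>)
  moreover have "V \<subseteq> {..<st (Suc i)}"
    using t(3) layout_order[of "st i"] i by (auto simp: st_Suc)
  moreover have "?m (tab 2 (st j)) \<in> V \<and> \<phi> (?m (tab 2 (st j))) = bits (st j)" if "j < Suc i" for j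
  proof (cases "j = i")
    case False
    then have j: "j < i" using that by simp
    then have f: "st j < B * B" using trans_facts[of j "st j"] i by simp
    have "?m (tab 2 (st j)) = m (tab 2 (st j))"
      using f fi j i upd by (simp add: tab_eq_iff st_eq_iff)
    then show ?thesis using ids j t(2,4) by auto
  qed (use t in simp)
  ultimately show ?thesis unfolding ids_ok_def by blast
qed

lemma wp_index_body:
  assumes i: "i < M" and "integral" and r: "bases r" "r 6 = st i" "r 7 = M - i" "r 0 = 1"
    and m: "index_ok m i"
  shows "wp W index_body (\<lambda>t r' m'. bases r' \<and> r' 6 = st (Suc i) \<and> r' 7 = M - Suc i \<and> r' 0 = 1 \<and>
    index_ok m' (Suc i) \<and> t \<le> 40 + 20 * n) r m"
proof -
  define e where "e = st i"
  have mem: "memory_ok m" "det_ok m i" "lists_ok m i" "ids_ok m i" "clean m"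
    using m by (auto simp: index_ok_def)
  note f = trans_facts[OF i e_def]
  obtain \<phi>0 V0 where ids: "trie m \<phi>0 V0" "V0 \<subseteq> {..<e}"
    "\<forall>j < i. m (tab 2 (st j)) \<in> V0 \<and> \<phi>0 (m (tab 2 (st j))) = bits (st j)"
    using mem(4) unfolding ids_ok_def e_def by blast
  have lt: "trie (link e m) \<phi>0 V0"
    using ids(1) by (rule trie_cong) (simp add: link_tab[OF i e_def])
  have den: "inp (den e) = 1" using assms(2) i by (simp add: integral_def e_def)
  let ?Q = "\<lambda>(t::nat) r' m'. bases r' \<and> r' 6 = st (Suc i) \<and> r' 7 = M - Suc i \<and> r' 0 = 1 \<and>
    index_ok m' (Suc i) \<and> t \<le> 40 + 20 * n"
  have r6: "r 6 = e" using r by (simp add: e_def)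
  show ?thesis unfolding index_body_def
  proof (rule wp_seqI[OF wp_index_prepare[OF i e_def r(1) r6 mem(1)]])
    fix t1 :: nat and r1 m1
    assume "t1 = 26 \<and> m1 = link e m \<and> bases r1 \<and> r1 6 = digs e \<and> r1 10 = dn e \<and> r1 23 = 0 \<and>
      r1 20 = e \<and> r1 7 = r 7 \<and> r1 0 = r 0"
    then have 1: "t1 = 26" "m1 = link e m" "bases r1" "r1 6 = digs e" "r1 10 = dn e" "r1 23 = 0"
      "r1 20 = e" "r1 7 = r 7" "r1 0 = r 0" by auto
    show "wp W (While 10 trie_body ;; index_finish) (\<lambda>u. ?Q (t1 + u)) r1 m1"
    proof (rule wp_seqI[OF walk[OF i e_def 1(3-6), where ?\<phi>0.0 = \<phi>0 and ?V0.0 = V0]])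
      show "memory_ok m1" "trie m1 \<phi>0 V0" "V0 \<subseteq> {..<e}"
        using 1 memory_ok_link[OF i e_def mem(1)] lt ids(2) by auto
    next
      fix t2 :: nat and r2 m2
      assume "walk_inv e \<phi>0 V0 m1 r2 m2 \<and> r2 10 = 0 \<and> r2 20 = r1 20 \<and> r2 7 = r1 7 \<and> r2 0 = r1 0 \<and>
        t2 \<le> Suc (20 * dn e)"
      then have 2: "walk_inv e \<phi>0 V0 m1 r2 m2" "r2 10 = 0" "r2 20 = e" "r2 7 = M - i" "r2 0 = 1"
        "t2 \<le> Suc (20 * dn e)"
        using 1 r by auto
      then have w: "bases r2" "memory_ok m2" "r2 6 = den e"
        "\<And>k x. k \<noteq> 1 \<Longrightarrow> x < B * B \<Longrightarrow> m2 (tab k x) = link e m (tab k x)"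
        "trie_state \<phi>0 V0 m2 (den e) (r2 23) (bits e)"
        unfolding walk_inv_def 1 by (auto simp: bits_def)
      let ?m = "m2(tab 2 e := r2 23)"
      have d: "den e < B" "after_num (den e) = den e + 2" "st (Suc i) = den e + 2"
        using layout_order[of e] st_Suc_le[OF i] den st_Suc[OF i]
        by (simp_all add: e_def after_num_def)
      have v: "r2 23 < den e" using w(5) unfolding trie_state_def by auto
      have up: "?m (tab k x) = link e m (tab k x)" if "k \<noteq> 1" "k \<noteq> 2" "x < B * B" for k x
        using that f w(4) by (simp add: tab_eq_iff)
      have "index_ok ?m (Suc i)"
        unfolding index_ok_def
      proof (intro conjI)
        show "memory_ok ?m" using w(2) v d by (intro memory_ok_upd) auto
        show "det_ok ?m (Suc i)"
          by (rule det_ok_Suc[OF i mem(2)], unfold e_def[symmetric], rule up) auto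
        show "lists_ok ?m (Suc i)"
        proof (rule lists_ok_Suc[OF i mem(3)])
          fix k x :: nat assume "k = 4 \<or> k = 5" "x < B * B"
          then show "?m (tab k x) = link (st i) m (tab k x)"
            unfolding e_def[symmetric] by (intro up) auto
        qed
        show "ids_ok ?m (Suc i)"
          unfolding e_def
        proof (rule ids_ok_Suc[OF i ids(3)])
          show "trie_state \<phi>0 V0 m2 (den (st i)) (r2 23) (bits (st i))"
            using w(5) by (simp add: e_def)
          show "m2 (tab 2 x) = m (tab 2 x)" if "x < B * B" for x
            using w(4)[of 2 x] link_tab[OF i e_def that] that by simp
        qed
        show "clean ?m"
          using up mem(5) link_tab[OF i e_def] by (simp add: clean_def)
      qed
      moreover have "20 * dn e \<le> 20 * n" using dn_le[OF i] by (simp add: e_def)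
      moreover have "tab 2 e < W" using f by (intro tab_less_W) auto
      moreover have "r2 23 < W" "2 < W" "den e + 2 < W" "M - (i + 1) < W"
        using v d B_less_W B_ge M_le_B by linarith+
      moreover have "r2 2 = 1" "r2 12 = tab 2 0"
        using w(1) by (simp_all add: bases_def)
      moreover have "M - i - 1 = M - Suc i" by simp
      ultimately show "wp W index_finish (\<lambda>u. ?Q (t1 + (t2 + u))) r2 m2"
        using w(1,3) 1(1) 2(3-6) d(3) unfolding index_finish_def
        by (simp del: One_nat_def)
    qed
  qed
qed

lemma index_loop:
  assumes "integral" "bases r" "r 6 = st 0" "r 7 = M" "r 0 = 1" "index_ok m 0"
  shows "wp W (While 7 index_body) (\<lambda>t r' m'. bases r' \<and> r' 0 = 1 \<and> index_ok m' M \<and>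
    t \<le> Suc ((50 + 20 * n) * M)) r m"
proof (rule wp_while[where \<Phi> = "\<lambda>r m. (50 + 20 * n) * r 7" and
      I = "\<lambda>r m. r 7 \<le> M \<and> bases r \<and> r 0 = 1 \<and> r 6 = st (M - r 7) \<and> index_ok m (M - r 7)"],
    goal_cases)
  case 1
  then show ?case using assms by simp
next
  case (2 r m)
  define i where "i = M - r 7"
  have i: "i < M" "r 7 = M - i" using 2 by (auto simp: i_def)
  have "M - (M - Suc i) = Suc i" using i by simp
  moreover have "(50 + 20 * n) * (M - i) = (50 + 20 * n) * (M - Suc i) + (50 + 20 * n)"
    unfolding Suc_diff_Suc[OF i(1), symmetric] by (simp only: mult_Suc_right add.commute)
  ultimately show ?case
    by (intro wp_mono[OF wp_index_body[OF i(1) assms(1)]]) (use 2 i in auto)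
next
  case (3 r' m' t)
  then show ?case using assms by simp
qed


section \<open>Exploring pairs of states\<close>

lemma prev_cases: "prev p x = 0 \<or> (\<exists>j < M. prev p x = st j \<and> src (st j) = p)"
proof -
  have "prev p x \<in> insert 0 (st ` {j. j < M \<and> src (st j) = p \<and> st j < x})"
    unfolding prev_def by (rule Max_in) auto
  then show ?thesis by auto
qed

text \<open>The maximum is an address below \<open>x\<close> or the default 0, and 0 is below the
  address of every transition.\<close>

lemma le_prev_iff:
  assumes "j < M" "src (st j) = p"
  shows "st j \<le> prev p x \<longleftrightarrow> st j < x"
proof
  assume "st j < x"
  then show "st j \<le> prev p x"
    unfolding prev_def using assms by (intro Max_ge) auto
next
  assume le: "st j \<le> prev p x"
  have "prev p x \<in> insert 0 (st ` {j. j < M \<and> src (st j) = p \<and> st j < x})"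
    unfolding prev_def by (rule Max_in) auto
  then show "st j < x"
    using le st_ge[of j] assms by auto
qed

definition outs :: "nat \<Rightarrow> nat set" where
  "outs p = {j. j < M \<and> src (st j) = p}"

text \<open>For a list element \<open>e\<close> this is the length of the list from \<open>e\<close>
  on, expressed without following pointers.\<close>

definition remaining :: "nat \<Rightarrow> nat \<Rightarrow> nat" where
  "remaining p e = card {j \<in> outs p. st j \<le> e}"

lemma finite_outs [simp]: "finite (outs p)"
  by (simp add: outs_def)

lemma remaining_prev:
  assumes "j \<in> outs p"
  shows "remaining p (st j) = Suc (remaining p (prev p (st j)))"
proof -
  have "{i \<in> outs p. st i \<le> st j} = insert j {i \<in> outs p. st i \<le> prev p (st j)}"
  proof -
    have "st i \<le> st j \<longleftrightarrow> i = j \<or> st i < st j" if "i \<in> outs p" for i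
      using that assms st_eq_iff[of i j] by (auto simp: outs_def)
    then show ?thesis
      using assms by (auto simp: outs_def le_prev_iff)
  qed
  moreover have "j \<notin> {i \<in> outs p. st i \<le> prev p (st j)}"
    using assms by (auto simp: outs_def le_prev_iff)
  ultimately show ?thesis by (simp add: remaining_def)
qed

lemma remaining_head: "remaining p (prev p (st M)) = card (outs p)"
proof -
  have "{i \<in> outs p. st i \<le> prev p (st M)} = outs p"
    by (auto simp: outs_def le_prev_iff st_less_iff)
  then show ?thesis by (simp add: remaining_def)
qed

lemma remaining_0 [simp]: "remaining p 0 = 0"
proof -
  have "{j \<in> outs p. st j \<le> 0} = {}"
  proof -
    have "0 < st j" if "j \<in> outs p" for j
      using st_ge[of j] that by (simp add: outs_def)
    then show ?thesis by auto
  qed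
  then show ?thesis by (simp add: remaining_def)
qed

text \<open>Every transition has one source. This keeps the search quadratic: for a fixed first
  state, the transitions of all second states together number only \<open>M\<close>.\<close>

lemma sum_outs: "(\<Sum>p<N. card (outs p)) = M"
proof -
  have "(\<Sum>p<N. card (outs p)) = card (\<Union>p<N. outs p)"
    by (rule card_UN_disjoint[symmetric]) (auto simp: outs_def)
  also have "(\<Union>p<N. outs p) = {..<M}"
    using src_less by (auto simp: outs_def)
  finally show ?thesis by simp
qed

section \<open>The queue of pairs and its initial contents\<close>

definition queue :: "(nat \<Rightarrow> nat) \<Rightarrow> nat \<Rightarrow> (nat \<times> nat) list" where
  "queue m b = map (\<lambda>i. (m (tab 7 i), m (tab 8 i))) [0..<b]"

lemma length_queue [simp]: "length (queue m b) = b"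
  by (simp add: queue_def)

lemma nth_queue: "i < b \<Longrightarrow> queue m b ! i = (m (tab 7 i), m (tab 8 i))"
  by (simp add: queue_def)

text \<open>Popped pairs stay in the array, so it records every pair found so far and table 6 is its
  characteristic function. Distinctness bounds its length.\<close>

definition queue_ok :: "(nat \<Rightarrow> nat) \<Rightarrow> nat \<Rightarrow> bool" where
  "queue_ok m b \<longleftrightarrow> distinct (queue m b) \<and> set (queue m b) \<subseteq> {..<N} \<times> {..<N} \<and>
     (\<forall>s < N. \<forall>p < N. m (tab 6 (s * B + p)) \<noteq> 0 \<longleftrightarrow> (s, p) \<in> set (queue m b))"

definition enqueue :: "nat \<Rightarrow> nat \<Rightarrow> nat \<Rightarrow> (nat \<Rightarrow> nat) \<Rightarrow> nat \<Rightarrow> nat" where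
  "enqueue s p b m = m(tab 6 (s * B + p) := 1, tab 7 b := s, tab 8 b := p)"

text \<open>A duplicate-free queue that misses a pair of states is shorter than
  \<open>N * N\<close>, so tables 7 and 8 have room for that pair.\<close>

lemma queue_length_less:
  assumes "queue_ok m b" "s < N" "p < N" "(s, p) \<notin> set (queue m b)"
  shows "b < B * B"
proof -
  have "b = card (set (queue m b))"
    using assms(1) by (simp add: queue_ok_def distinct_card)
  also have "\<dots> < card ({..<N} \<times> {..<N})"
    using assms by (intro psubset_card_mono) (auto simp: queue_ok_def)
  also have "\<dots> \<le> B * B"
    using N_le_B by (simp add: mult_le_mono)
  finally show ?thesis .
qed

lemma queue_length_le: "queue_ok m b \<Longrightarrow> b \<le> B * B"
proof -
  assume q: "queue_ok m b"
  then have "b = card (set (queue m b))"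
    by (simp add: queue_ok_def distinct_card)
  also have "\<dots> \<le> card ({..<N} \<times> {..<N})"
    using q by (intro card_mono) (auto simp: queue_ok_def)
  also have "\<dots> \<le> B * B"
    using N_le_B by (simp add: mult_le_mono)
  finally show ?thesis .
qed

lemma state_facts: "s < N \<Longrightarrow> s < B" "s < N \<Longrightarrow> p < B \<Longrightarrow> s * B + p < B * B"
  using N_le_B by (auto intro: pair_index_less)

lemma enqueue_tab:
  assumes "s < N" "p < N" "b < B * B" "x < B * B"
  shows "enqueue s p b m (tab k x) =
    (if k = 8 \<and> x = b then p else if k = 7 \<and> x = b then s
     else if k = 6 \<and> x = s * B + p then 1 else m (tab k x))"
  using assms state_facts by (simp add: enqueue_def tab_eq_iff)

lemma queue_enqueue:
  assumes "s < N" "p < N" "b < B * B"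
  shows "queue (enqueue s p b m) (Suc b) = queue m b @ [(s, p)]"
  using assms by (simp add: queue_def enqueue_tab)

lemma queue_ok_enqueue:
  assumes q: "queue_ok m b" and sp: "s < N" "p < N" "(s, p) \<notin> set (queue m b)"
  shows "queue_ok (enqueue s p b m) (Suc b)"
proof -
  note b = queue_length_less[OF assms]
  have "enqueue s p b m (tab 6 (s' * B + p')) \<noteq> 0 \<longleftrightarrow> (s', p') \<in> set (queue m b @ [(s, p)])"
    if "s' < N" "p' < N" for s' p'
    using that q state_facts sp pair_index_eq[of p' p s' s]
    by (subst enqueue_tab[OF sp(1,2) b]) (auto simp: queue_ok_def)
  then show ?thesis
    using q sp unfolding queue_ok_def queue_enqueue[OF sp(1,2) b] by auto
qed

lemma memory_ok_enqueue:
  "memory_ok m \<Longrightarrow> s < N \<Longrightarrow> p < N \<Longrightarrow> memory_ok (enqueue s p b m)"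
  unfolding enqueue_def using state_facts(1) B_ge by (intro memory_ok_upd) auto

definition init_pairs :: "nat \<Rightarrow> (nat \<times> nat) list" where
  "init_pairs i = map (\<lambda>j. (inp 4, inp (4 + j))) [0..<i]"

definition same_index :: "(nat \<Rightarrow> nat) \<Rightarrow> (nat \<Rightarrow> nat) \<Rightarrow> bool" where
  "same_index m0 m \<longleftrightarrow> memory_ok m \<and> (\<forall>k x. k \<le> 5 \<longrightarrow> x < B * B \<longrightarrow> m (tab k x) = m0 (tab k x))"

lemma same_index_enqueue:
  "same_index m0 m \<Longrightarrow> s < N \<Longrightarrow> p < N \<Longrightarrow> b < B * B \<Longrightarrow> same_index m0 (enqueue s p b m)"
  by (auto simp: same_index_def memory_ok_enqueue enqueue_tab)

lemma init_loop:
  assumes idx: "memory_ok m" "clean m"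
    and r: "bases r" "r 0 = 1" "r 7 = nI" "r 24 = 4" "r 25 = inp 4" "r 26 = 0" "r 27 = 0"
  shows "wp W (While 7 init_body) (\<lambda>t r' m'. bases r' \<and> r' 0 = 1 \<and> r' 26 = 0 \<and> r' 27 = nI \<and>
    same_index m m' \<and> queue_ok m' nI \<and> queue m' nI = init_pairs nI \<and> t \<le> Suc (20 * nI)) r m"
proof (rule wp_while[where \<Phi> = "\<lambda>r m. 20 * r 7" and
      I = "\<lambda>r' m'. bases r' \<and> r' 0 = 1 \<and> r' 26 = 0 \<and> r' 25 = inp 4 \<and> r' 7 + r' 27 = nI \<and>
        r' 24 = 4 + r' 27 \<and> same_index m m' \<and> queue_ok m' (r' 27) \<and>
        queue m' (r' 27) = init_pairs (r' 27)"], goal_cases)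
  case 1
  have "m (tab 6 (s * B + p)) = 0" if "s < N" "p < N" for s p
    using that idx(2) state_facts by (simp add: clean_def)
  then show ?case
    using r idx by (simp add: queue_ok_def queue_def init_pairs_def same_index_def)
next
  case (2 r' m')
  define i where "i = r' 27"
  have i: "i < nI" "r' 7 = nI - i" "r' 24 = 4 + i" "r' 25 = inp 4" "r' 27 = i" "r' 26 = 0" "r' 0 = 1"
    and inv: "bases r'" "same_index m m'" "queue_ok m' i" "queue m' i = init_pairs i"
    using 2 by (auto simp: i_def)
  have p: "inp 4 < N" "inp (4 + i) < N"
    using init_less[of 0] init_less[OF i(1)] i(1) by auto
  have new: "(inp 4, inp (4 + i)) \<notin> set (queue m' i)"
  proof
    assume "(inp 4, inp (4 + i)) \<in> set (queue m' i)"
    then obtain j where j: "j < i" "inp (4 + j) = inp (4 + i)"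
      by (auto simp: inv(4) init_pairs_def)
    then show False
      using inj_onD[OF init_inj, of j i] i(1) by simp
  qed
  note b = queue_length_less[OF inv(3) p new]
  have t: "tab 6 (inp 4 * B + inp (4 + i)) < W" "tab 7 i < W" "tab 8 i < W"
    using b state_facts p by (auto intro!: tab_less_W)
  have sm: "inp 4 * B + inp (4 + i) < B * B"
    using state_facts p by auto
  have lim: "1 < W" "4 + i < W" "i + 1 < W" "4 + i + 1 < W" "inp 4 < W" "inp (4 + i) < W" "nI - i - 1 < W"
    "inp 4 * B < W" "inp 4 * B + inp (4 + i) < W"
    using st_ge[of M] st_M i(1) B_less_W W sm state_facts(1)[OF p(1)] state_facts(1)[OF p(2)]
    by linarith+
  have ld: "m' (4 + i) = inp (4 + i)"
    using inv(2) st_ge[of M] st_M i(1) by (auto simp: same_index_def memory_ok_inp)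
  have ip: "init_pairs (Suc i) = init_pairs i @ [(inp 4, inp (4 + i))]"
    by (simp add: init_pairs_def)
  have enq: "m'(tab 6 (inp 4 * B + inp (4 + i)) := 1, tab 7 i := inp 4, tab 8 i := inp (4 + i)) =
      enqueue (inp 4) (inp (4 + i)) i m'"
    by (simp add: enqueue_def)
  have post: "same_index m (enqueue (inp 4) (inp (4 + i)) i m')"
    "queue_ok (enqueue (inp 4) (inp (4 + i)) i m') (i + 1)"
    "queue (enqueue (inp 4) (inp (4 + i)) i m') (i + 1) = init_pairs (i + 1)"
    using same_index_enqueue[OF inv(2) p b] queue_ok_enqueue[OF inv(3) p new]
      queue_enqueue[OF p b] inv(4) ip by simp_all
  have "r' 2 = 1" "r' 5 = B" "r' 16 = tab 6 0" "r' 17 = tab 7 0" "r' 18 = tab 8 0"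
    using inv(1) by (simp_all add: bases_def)
  moreover have "nI - i - 1 + (i + 1) = nI" "20 * (nI - i - 1) + 20 = 20 * (nI - i)"
    "4 + i + 1 = 4 + (i + 1)"
    using i by simp_all
  ultimately show ?case
    using i inv(1) t lim ld post unfolding init_body_def
    by (simp add: enq del: One_nat_def)
next
  case (3 r' m' t)
  then show ?case using r by auto
qed


section \<open>The product of the deterministic run with all runs, and its exploration\<close>

inductive_set reach :: "(nat \<Rightarrow> nat \<Rightarrow> nat) \<Rightarrow> (nat \<times> nat) set" for d where
  reach_init: "i < nI \<Longrightarrow> (inp 4, inp (4 + i)) \<in> reach d"
| reach_step: "(s, p) \<in> reach d \<Longrightarrow> j \<in> outs p \<Longrightarrow>
    (dst (d s (lab (st j))), dst (st j)) \<in> reach d"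

definition consistent :: "(nat \<Rightarrow> nat \<Rightarrow> nat) \<Rightarrow> bool" where
  "consistent d \<longleftrightarrow> (\<forall>(s, p) \<in> reach d. \<forall>j \<in> outs p. bits (st j) = bits (d s (lab (st j))))"

definition det_of :: "(nat \<Rightarrow> nat) \<Rightarrow> nat \<Rightarrow> nat \<Rightarrow> nat" where
  "det_of m s a = m (tab 3 (s * B + a))"

text \<open>Completeness yields a transition from \<open>s\<close> with this letter. Indexing it has
  filled the entry of table 3, perhaps since overwritten by another of the same kind.\<close>

lemma det_of_step:
  assumes "index_ok m M" "s < N" "j < M"
  shows "\<exists>k < M. det_of m s (lab (st j)) = st k \<and> src (st k) = s \<and> lab (st k) = lab (st j)"
proof -
  obtain i where "i < M" "src (st i) = s" "lab (st i) = lab (st j)"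
    using complete[OF assms(2,3)] by blast
  moreover have "det_ok m M"
    using assms(1) by (simp add: index_ok_def)
  ultimately obtain k where "k < M" "m (tab 3 (src (st i) * B + lab (st i))) = st k"
    "src (st k) = src (st i)" "lab (st k) = lab (st i)"
    unfolding det_ok_def by blast
  then show ?thesis
    using \<open>src (st i) = s\<close> \<open>lab (st i) = _\<close> by (intro exI[of _ k]) (simp add: det_of_def)
qed

lemma ids_eq_iff:
  assumes "index_ok m M" "i < M" "j < M"
  shows "m (tab 2 (st i)) = m (tab 2 (st j)) \<longleftrightarrow> bits (st i) = bits (st j)"
proof -
  have "ids_ok m M"
    using assms(1) by (simp add: index_ok_def)
  then obtain \<phi> V where V: "trie m \<phi> V"
    "\<And>j. j < M \<Longrightarrow> m (tab 2 (st j)) \<in> V \<and> \<phi> (m (tab 2 (st j))) = bits (st j)"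
    unfolding ids_ok_def by blast
  then have "inj_on \<phi> V"
    by (simp add: trie_def)
  then show ?thesis
    using V(2)[OF assms(2)] V(2)[OF assms(3)] inj_on_eq_iff by metis
qed

text \<open>The potential of the search. A pair not yet popped costs one round for the pop and one
  per transition from its second state; \<open>remaining\<close> counts the rounds left for the
  current pair. All pairs of states are summed, enqueued or not, so a push changes nothing.\<close>

definition pending :: "(nat \<Rightarrow> nat) \<Rightarrow> (nat \<Rightarrow> nat) \<Rightarrow> nat" where
  "pending r m = (\<Sum>x \<in> {..<N} \<times> {..<N} - set (take (r 26) (queue m (r 27))). Suc (card (outs (snd x)))) +
     remaining (r 21) (r 20)"

context
  fixes m0 :: "nat \<Rightarrow> nat"
  assumes idx: "index_ok m0 M"
begin

definition expanded :: "(nat \<times> nat) set \<Rightarrow> nat \<times> nat \<Rightarrow> nat \<Rightarrow> bool" where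
  "expanded S x j \<longleftrightarrow> bits (st j) = bits (det_of m0 (fst x) (lab (st j))) \<and>
     (dst (det_of m0 (fst x) (lab (st j))), dst (st j)) \<in> S"

text \<open>While register 20 holds a transition, the pair popped last, at position \<open>r 26 - 1\<close>, still
  has to be expanded along this transition and those before it.\<close>

definition search_inv :: "(nat \<Rightarrow> nat) \<Rightarrow> (nat \<Rightarrow> nat) \<Rightarrow> bool" where
  "search_inv r m \<longleftrightarrow> bases r \<and> same_index m0 m \<and> queue_ok m (r 27) \<and> r 26 \<le> r 27 \<and>
     set (queue m (r 27)) \<subseteq> reach (det_of m0) \<and> set (init_pairs nI) \<subseteq> set (queue m (r 27)) \<and>
     (r 20 \<noteq> 0 \<longrightarrow> 0 < r 26 \<and> queue m (r 27) ! (r 26 - 1) = (r 25, r 21) \<and>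
        r 20 \<in> st ` outs (r 21)) \<and>
     (\<forall>k < r 26. \<forall>j \<in> outs (snd (queue m (r 27) ! k)).
        Suc k = r 26 \<and> st j \<le> r 20 \<or> expanded (set (queue m (r 27))) (queue m (r 27) ! k) j)"

lemma dst_reach: "(s, p) \<in> reach (det_of m0) \<Longrightarrow> s < N \<and> p < N"
proof (induction rule: reach.induct)
  case (reach_init i)
  then show ?case using init_less[of 0] init_less[of i] by simp
next
  case (reach_step s p j)
  then have "j < M" by (simp add: outs_def)
  then show ?case
    using det_of_step[OF idx _ \<open>j < M\<close>, of s] reach_step.IH dst_less by auto
qed

lemma wp_pop_empty:
  assumes "r 27 = r 26" "0 < W"
  shows "wp W pop (\<lambda>t r' m'. t = 3 \<and> m' = m \<and> r' = r(8 := 0, 7 := 0)) r m"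
  using assms by (simp add: pop_def)

lemma wp_pop:
  assumes r: "bases r" "r 26 < r 27" and m: "same_index m0 m" "queue_ok m (r 27)"
  shows "wp W pop (\<lambda>t r' m'. t = 9 \<and> m' = m \<and> bases r' \<and> r' 25 = m (tab 7 (r 26)) \<and>
    r' 21 = m (tab 8 (r 26)) \<and> r' 26 = r 26 + 1 \<and> r' 20 = prev (r' 21) (st M) \<and>
    r' 0 = r 0 \<and> r' 7 = r 7 \<and> r' 27 = r 27) r m"
proof -
  define f where "f = r 26"
  have f: "f < B * B" "f < r 27"
    using queue_length_le[OF m(2)] r(2) by (auto simp: f_def)
  have "queue m (r 27) ! f \<in> {..<N} \<times> {..<N}"
    using m(2) f(2) nth_mem[of f "queue m (r 27)"] unfolding queue_ok_def by auto
  then have p: "m (tab 8 f) < N" by (simp add: nth_queue f)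
  have "m (tab 5 (m (tab 8 f))) = m0 (tab 5 (m (tab 8 f)))"
    using m(1) state_facts(1)[OF p] B_le_sq by (simp add: same_index_def)
  also have "\<dots> = prev (m (tab 8 f)) (st M)"
    using idx p by (simp add: index_ok_def lists_ok_def)
  finally have h: "m (tab 5 (m (tab 8 f))) = prev (m (tab 8 f)) (st M)" .
  have w: "m x < W" for x
    using m(1) by (auto simp: same_index_def intro: memory_ok_less)
  have h': "prev (m (tab 8 f)) (st M) < W" using w h by metis
  have t: "tab 7 f < W" "tab 8 f < W" "tab 5 (m (tab 8 f)) < W"
    using f state_facts(1)[OF p] B_le_sq by (auto intro: tab_less_W)
  have "f + 1 < W" "r 27 - f < W" "r 27 - f \<noteq> 0"
    using W f queue_length_le[OF m(2)] B_le_square B_ge by linarith+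
  moreover have "r 2 = 1" "r 17 = tab 7 0" "r 18 = tab 8 0" "r 15 = tab 5 0"
    using r(1) by (simp_all add: bases_def)
  ultimately show ?thesis
    using r(1) w t h h' unfolding pop_def f_def[symmetric]
    by (simp add: f_def[symmetric] del: One_nat_def)
qed

lemma wp_compare:
  assumes r: "bases r" "r 20 = st j" "r 25 = s" and j: "j < M" and s: "s < N"
    and m: "same_index m0 m" and d: "d = det_of m0 s (lab (st j))"
  shows "wp W compare (\<lambda>t r' m'. t = 15 \<and> m' = m \<and> bases r' \<and> r' 9 = dst (st j) \<and> r' 10 = d \<and>
    (r' 8 = 0 \<longleftrightarrow> bits (st j) = bits d) \<and>
    r' 0 = r 0 \<and> r' 7 = r 7 \<and> r' 20 = st j \<and> r' 21 = r 21 \<and> r' 25 = s \<and> r' 26 = r 26 \<and>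
    r' 27 = r 27) r m"
proof -
  obtain k where k: "k < M" "d = st k"
    using det_of_step[OF idx s j] d by auto
  define e where "e = st j"
  note f = trans_facts[OF j e_def] trans_facts[OF k]
  have x: "s * B + lab e < B * B" using state_facts(2)[OF s] f by auto
  have mem: "memory_ok m" "\<And>k x. k \<le> 5 \<Longrightarrow> x < B * B \<Longrightarrow> m (tab k x) = m0 (tab k x)"
    using m by (auto simp: same_index_def)
  have ld: "m (e + 1) = lab e" "m (e + 1 + 1) = dst e" "m (tab 3 (s * B + lab e)) = d"
    "m (tab 2 d) = m0 (tab 2 d)" "m (tab 2 e) = m0 (tab 2 e)"
    using f x mem by (simp_all add: memory_ok_inp lab_def dst_def d det_of_def e_def)
  have w: "m x < W" "m0 x < W" "m x < B" "m0 x < B" for x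
    using mem(1) idx by (auto simp: index_ok_def intro: memory_ok_less)
  have w': "dst e < W" "d < W" "lab e < W"
    using f B_less_W N_le_B by linarith+
  have t: "tab 3 (s * B + lab e) < W" "tab 2 d < W" "tab 2 e < W"
    using f x by (auto intro: tab_less_W)
  have lim: "e + 1 < W" "e + 1 + 1 < W" "s * B < W" "s * B + lab e < W"
    using f x W B_less_W by linarith+
  have dif: "m0 x - m0 y < W" "m0 x - m0 y + (m0 y - m0 x) < W" for x y
    using w(4)[of x] w(4)[of y] B_less_W by linarith+
  have "m0 (tab 2 d) - m0 (tab 2 e) = 0 \<and> m0 (tab 2 e) - m0 (tab 2 d) = 0 \<longleftrightarrow> bits e = bits d"
    using ids_eq_iff[OF idx j k(1)] k e_def by auto
  moreover have "r 2 = 1" "r 5 = B" "r 12 = tab 2 0" "r 13 = tab 3 0"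
    using r(1) by (simp_all add: bases_def)
  ultimately show ?thesis
    using r w' t lim dif w unfolding compare_def e_def[symmetric]
    by (simp add: ld del: One_nat_def diff_is_0_eq)
qed

lemma wp_push:
  assumes r: "bases r" "r 10 = d" "r 9 = p" "r 20 = st j" and j: "j < M" and k: "k < M" "d = st k"
    and p: "p < N" and m: "same_index m0 m" "queue_ok m (r 27)"
  shows "wp W push (\<lambda>t r' m'. t \<le> 20 \<and> bases r' \<and>
    (if (dst d, p) \<in> set (queue m (r 27)) then m' = m \<and> r' 27 = r 27
     else m' = enqueue (dst d) p (r 27) m \<and> r' 27 = r 27 + 1) \<and>
    r' 20 = prev (src (st j)) (st j) \<and>
    r' 0 = r 0 \<and> r' 7 = r 7 \<and> r' 21 = r 21 \<and> r' 25 = r 25 \<and> r' 26 = r 26) r m"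
proof -
  define b where "b = r 27"
  define e where "e = st j"
  note f = trans_facts[OF j e_def] trans_facts[OF k]
  have x: "dst d * B + p < B * B" using state_facts f p by auto
  have mem: "memory_ok m" "\<And>k x. k \<le> 5 \<Longrightarrow> x < B * B \<Longrightarrow> m (tab k x) = m0 (tab k x)"
    using m(1) by (auto simp: same_index_def)
  have ld: "m (Suc (Suc d)) = dst d"
    using f mem by (simp add: memory_ok_inp dst_def)
  have nx: "m (tab 4 e) = prev (src e) e"
    using f mem idx j by (simp add: index_ok_def lists_ok_def e_def)
  have w: "m x < W" for x
    using mem(1) by (rule memory_ok_less)
  have w': "prev (src e) e < W" using w nx by metis
  have t: "tab 4 e < W" "tab 6 (dst d * B + p) < W"
    using f x by (auto intro: tab_less_W)
  have lim: "2 < W" "1 < W" "2 + d < W" "dst d * B < W" "dst d * B + p < W" "dst d < W" "p < W"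
    using f x p W B_less_W N_le_B by linarith+
  have vis: "m (tab 6 (dst d * B + p)) \<noteq> 0 \<longleftrightarrow> (dst d, p) \<in> set (queue m b)"
    using m(2) f p by (simp add: queue_ok_def b_def)
  have rr: "r 2 = 1" "r 5 = B" "r 14 = tab 4 0" "r 16 = tab 6 0" "r 17 = tab 7 0" "r 18 = tab 8 0"
    using r(1) by (simp_all add: bases_def)
  show ?thesis
  proof (cases "(dst d, p) \<in> set (queue m b)")
    case True
    then show ?thesis
      using r rr w w' t lim vis unfolding push_def e_def[symmetric] b_def[symmetric]
      by (simp add: ld nx b_def[symmetric] del: One_nat_def)
  next
    case False
    have b: "b < B * B"
      using queue_length_less[of m b "dst d" p] m(2) f p False by (simp add: b_def)
    have tb: "tab 7 b < W" "tab 8 b < W" "b + 1 < W"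
      using b W B_le_square B_ge by (auto intro: tab_less_W)
    have enq: "m(tab 6 (dst d * B + p) := 1, tab 7 b := dst d, tab 8 b := p) = enqueue (dst d) p b m"
      by (simp add: enqueue_def)
    have nx': "enqueue (dst d) p b m (tab 4 e) = prev (src e) e"
      using f p b nx by (simp add: enqueue_tab)
    show ?thesis
      using r rr w w' t tb lim vis False unfolding push_def e_def[symmetric] b_def[symmetric]
      by (simp add: ld nx' enq b_def[symmetric] del: One_nat_def)
  qed
qed


lemma search_inv_queue:
  assumes "search_inv r m" "k < r 27"
  shows "queue m (r 27) ! k \<in> reach (det_of m0)"
  using assms nth_mem[of k "queue m (r 27)"] by (auto simp: search_inv_def)

lemma search_inv_pop:
  assumes inv: "search_inv r m" "r 20 = 0" "r 26 < r 27"
    and r': "bases r'" "r' 25 = m (tab 7 (r 26))" "r' 21 = m (tab 8 (r 26))" "r' 26 = r 26 + 1"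
      "r' 20 = prev (r' 21) (st M)" "r' 27 = r 27"
  shows "search_inv r' m \<and> Suc (pending r' m) = pending r m"
proof
  define Q f p where "Q = queue m (r 27)" and "f = r 26" and "p = r' 21"
  have x: "Q ! f = (r' 25, p)"
    using nth_queue[OF inv(3)] r' by (simp add: Q_def f_def p_def)
  have q: "queue_ok m (r 27)" "f < length Q"
    using inv by (auto simp: search_inv_def Q_def f_def)
  have proc: "Suc k = Suc f \<and> st j \<le> r' 20 \<or> expanded (set Q) (Q ! k) j"
    if k: "k < Suc f" and j: "j \<in> outs (snd (Q ! k))" for k j
  proof (cases "k = f")
    case True
    then have "j \<in> outs p" using j x by simp
    then have "st j \<le> r' 20"
      using le_prev_iff[of j p "st M"] st_less_iff[of j M] r'(5)
      by (simp add: outs_def p_def)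
    then show ?thesis using True by simp
  next
    case False
    then have "Suc k = r 26 \<and> st j \<le> r 20 \<or> expanded (set Q) (Q ! k) j"
      using inv(1) k j unfolding search_inv_def Q_def f_def by auto
    \<comment> \<open>With register 20 at 0 the exception made for the current pair is void, because
      transitions have positive addresses.\<close>
    moreover have "0 < st j"
      using st_ge[of j] j by (simp add: outs_def)
    ultimately show ?thesis using inv(2) by auto
  qed
  have "r' 20 \<noteq> 0 \<longrightarrow> r' 20 \<in> st ` outs p"
    using prev_cases[of p "st M"] r'(5) by (auto simp: outs_def p_def)
  then show "search_inv r' m"
    using inv r'(1,4,6) x proc unfolding search_inv_def
    by (simp add: Q_def[symmetric] f_def[symmetric] p_def[symmetric])
  have d: "distinct Q" "set Q \<subseteq> {..<N} \<times> {..<N}"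
    using q by (auto simp: queue_ok_def Q_def)
  \<comment> \<open>Popping removes the summand of this pair, its out-degree plus one, and
    contributes the out-degree as \<open>remaining\<close>; the potential falls by one.\<close>
  then have nin: "Q ! f \<notin> set (take f Q)"
    using q(2) by (auto simp: in_set_conv_nth nth_eq_iff_index_eq)
  let ?g = "\<lambda>x. Suc (card (outs (snd x)))"
  have "sum ?g ({..<N} \<times> {..<N} - set (take f Q)) =
      ?g (Q ! f) + sum ?g ({..<N} \<times> {..<N} - set (take f Q) - {Q ! f})"
    using nin d q(2) nth_mem[OF q(2)] by (intro sum.remove) auto
  moreover have "{..<N} \<times> {..<N} - set (take f Q) - {Q ! f} =
      {..<N} \<times> {..<N} - set (take (Suc f) Q)"
    using q(2) by (auto simp: take_Suc_conv_app_nth)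
  ultimately show "Suc (pending r' m) = pending r m"
    using x r' inv(2) remaining_head[of p]
    by (simp add: pending_def Q_def[symmetric] f_def[symmetric] p_def[symmetric])
qed

lemma expanded_mono: "expanded S x j \<Longrightarrow> S \<subseteq> T \<Longrightarrow> expanded T x j"
  by (auto simp: expanded_def)

lemma search_inv_advance:
  assumes inv: "search_inv r m" and j: "r 20 = st j" "j \<in> outs (r 21)"
    and d: "d = det_of m0 (r 25) (lab (st j))" "bits (st j) = bits d"
    and r': "bases r'" "r' 20 = prev (r 21) (st j)" "r' 21 = r 21" "r' 25 = r 25" "r' 26 = r 26"
    and m': "if (dst d, dst (st j)) \<in> set (queue m (r 27)) then m' = m \<and> r' 27 = r 27
     else m' = enqueue (dst d) (dst (st j)) (r 27) m \<and> r' 27 = r 27 + 1"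
  shows "search_inv r' m' \<and> Suc (pending r' m') = pending r m"
proof
  define Q Q' f p where "Q = queue m (r 27)" and "Q' = queue m' (r' 27)" and "f = r 26" and "p = r 21"
  let ?x = "(dst d, dst (st j))"
  have "st j \<noteq> 0" "j < M"
    using st_ge[of j] j by (auto simp: outs_def)
  then have cur: "0 < f" "Q ! (f - 1) = (r 25, p)" and f: "f \<le> r 27" "length Q = r 27"
    and q: "queue_ok m (r 27)" "same_index m0 m" "set Q \<subseteq> reach (det_of m0)"
      "set (init_pairs nI) \<subseteq> set Q"
    using inv j(1) unfolding search_inv_def Q_def f_def p_def by simp_all
  have x: "?x \<in> reach (det_of m0)"
    using search_inv_queue[OF inv, of "f - 1"] cur f j d(1) reach_step[of "r 25" p _ j]
    by (simp add: Q_def p_def)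
  then have xN: "dst d < N" "dst (st j) < N"
    using dst_reach by auto
  \<comment> \<open>Whether pushed now or present before, the new pair ends up in the queue, and the
    popped prefix is untouched.\<close>
  have Q': "queue_ok m' (r' 27)" "same_index m0 m'" "f \<le> r' 27" "set Q' = insert ?x (set Q)"
    "\<And>k. k < f \<Longrightarrow> Q' ! k = Q ! k" "take f Q' = take f Q"
  proof -
    have "queue_ok m' (r' 27) \<and> same_index m0 m' \<and> f \<le> r' 27 \<and> set Q' = insert ?x (set Q) \<and>
      (\<forall>k < f. Q' ! k = Q ! k) \<and> take f Q' = take f Q"
    proof (cases "?x \<in> set Q")
      case True
      then have "m' = m" "r' 27 = r 27" using m' by (auto simp: Q_def)
      then show ?thesis
        using True q f by (auto simp: Q_def Q'_def)
    next
      case False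
      then have m'': "m' = enqueue (dst d) (dst (st j)) (r 27) m" "r' 27 = Suc (r 27)"
        using m' by (auto simp: Q_def)
      note b = queue_length_less[OF q(1) xN False[unfolded Q_def]]
      have "Q' = Q @ [?x]"
        using queue_enqueue[OF xN b] by (simp add: Q_def Q'_def m'')
      then show ?thesis
        using queue_ok_enqueue[OF q(1) xN False[unfolded Q_def]] same_index_enqueue[OF q(2) xN b] f
        by (auto simp: m'' nth_append)
    qed
    then show "queue_ok m' (r' 27)" "same_index m0 m'" "f \<le> r' 27" "set Q' = insert ?x (set Q)"
      "\<And>k. k < f \<Longrightarrow> Q' ! k = Q ! k" "take f Q' = take f Q"
      by simp_all
  qed
  have proc: "Suc k = f \<and> st i \<le> r' 20 \<or> expanded (set Q') (Q' ! k) i"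
    if k: "k < f" and i: "i \<in> outs (snd (Q' ! k))" for k i
  proof -
    have "Suc k = r 26 \<and> st i \<le> r 20 \<or> expanded (set Q) (Q ! k) i"
      using inv k i Q'(5)[OF k] unfolding search_inv_def Q_def f_def by auto
    then show ?thesis
    proof
      assume *: "Suc k = r 26 \<and> st i \<le> r 20"
      then have kf: "k = f - 1" "Suc k = f"
        by (auto simp: f_def)
      then have kQ: "Q' ! k = (r 25, p)"
        using cur Q'(5)[OF k] by simp
      then have ip: "i < M" "src (st i) = p" using i kQ by (auto simp: outs_def)
      show ?thesis
      \<comment> \<open>Transition \<open>j\<close> has just been treated; the other transitions of
        \<open>p\<close> up to \<open>st j\<close> are those up to \<open>prev p (st j)\<close>,
        still to come.\<close>
      proof (cases "i = j")
        case True
        then show ?thesis using kQ d Q'(4) by (simp add: expanded_def)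
      next
        case False
        then have "st i < st j"
          using * j(1) st_eq_iff[of i j] ip \<open>j < M\<close> by simp
        then show ?thesis
          using kf ip le_prev_iff[of i p "st j"] r'(2) by (simp add: p_def)
      qed
    next
      assume "expanded (set Q) (Q ! k) i"
      then have "expanded (set Q') (Q ! k) i"
        by (rule expanded_mono) (use Q'(4) in blast)
      then show ?thesis using Q'(5)[OF k] by simp
    qed
  qed
  have "r' 20 \<noteq> 0 \<longrightarrow> r' 20 \<in> st ` outs p"
    using prev_cases[of p "st j"] r'(2) by (auto simp: outs_def p_def)
  then show "search_inv r' m'"
    unfolding search_inv_def Q'_def[symmetric]
    using Q'(1-4) Q'(5)[of "f - 1"] q x cur proc r'(1,3-5)
    by (auto simp: f_def[symmetric] p_def[symmetric])
  show "Suc (pending r' m') = pending r m"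
    unfolding pending_def Q_def[symmetric] Q'_def[symmetric]
    using r'(2-5) Q'(6) remaining_prev[OF j(2)] j(1) by (simp add: f_def)
qed

text \<open>Every pair in the queue is now fully expanded. So the queue contains the initial pairs
  and is closed under steps, hence contains \<open>reach\<close>, and expansion includes the
  comparison of digits.\<close>

lemma consistent_end:
  assumes inv: "search_inv r m" "r 20 = 0" "r 26 = r 27"
  shows "consistent (det_of m0)"
proof -
  define Q where "Q = queue m (r 27)"
  have ex: "expanded (set Q) x j" if "x \<in> set Q" "j \<in> outs (snd x)" for x j
  proof -
    obtain k where k: "k < r 27" "x = Q ! k"
      using \<open>x \<in> set Q\<close> by (auto simp: in_set_conv_nth Q_def)
    then have "Suc k = r 26 \<and> st j \<le> r 20 \<or> expanded (set Q) (Q ! k) j"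
      using inv that(2) unfolding search_inv_def Q_def by simp
    moreover have "0 < st j"
      using st_ge[of j] that(2) by (simp add: outs_def)
    ultimately show ?thesis using inv(2) k by simp
  qed
  have "(s, p) \<in> set Q" if "(s, p) \<in> reach (det_of m0)" for s p
    using that
  proof (induction rule: reach.induct)
    case (reach_init i)
    then have "(inp 4, inp (4 + i)) \<in> set (init_pairs nI)"
      by (auto simp: init_pairs_def)
    then show ?case using inv(1) by (auto simp: search_inv_def Q_def)
  next
    case (reach_step s p j)
    then show ?case using ex[of "(s, p)" j] by (simp add: expanded_def)
  qed
  then show ?thesis
    using ex unfolding consistent_def expanded_def by fastforce
qed

lemma wp_search_body:
  assumes inv: "search_inv r m" and r: "r 7 = 1" "r 0 = 1"
  shows "wp W search_body (\<lambda>t r' m'. t < 49 \<and>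
    (r' 7 = 1 \<and> r' 0 = 1 \<and> search_inv r' m' \<and> Suc (pending r' m') = pending r m \<or>
     r' 7 = 0 \<and> r' 0 = (if consistent (det_of m0) then 1 else 0))) r m"
    (is "wp W search_body ?Q r m")
proof (cases "r 20 = 0")
  case True
  have i: "bases r" "same_index m0 m" "queue_ok m (r 27)" "r 26 \<le> r 27"
    using inv by (auto simp: search_inv_def)
  have "wp W pop (\<lambda>t. ?Q (Suc t)) r m"
  proof (cases "r 26 = r 27")
    case eq: True
    have c: "consistent (det_of m0)"
      by (rule consistent_end[OF inv True eq])
    have "0 < W" using W by simp
    show ?thesis
      by (rule wp_mono[OF wp_pop_empty[OF eq[symmetric] \<open>0 < W\<close>]]) (use c r in simp)
  next
    case False
    then have lt: "r 26 < r 27" using i by simp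
    show ?thesis
    proof (rule wp_mono[OF wp_pop[OF i(1) lt i(2,3)]])
      fix t :: nat and r' m'
      assume *: "t = 9 \<and> m' = m \<and> bases r' \<and> r' 25 = m (tab 7 (r 26)) \<and>
        r' 21 = m (tab 8 (r 26)) \<and> r' 26 = r 26 + 1 \<and> r' 20 = prev (r' 21) (st M) \<and>
        r' 0 = r 0 \<and> r' 7 = r 7 \<and> r' 27 = r 27"
      then have "search_inv r' m \<and> Suc (pending r' m) = pending r m"
        by (intro search_inv_pop[OF inv True lt]) auto
      then show "?Q (Suc t) r' m'" using * r by simp
    qed
  qed
  then show ?thesis using True by (simp add: search_body_def)
next
  case False
  then obtain j where j: "r 20 = st j" "j \<in> outs (r 21)" "j < M" "src (st j) = r 21"
    using inv by (auto simp: search_inv_def outs_def)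
  have i: "bases r" "same_index m0 m" "queue_ok m (r 27)" "0 < r 26" "r 26 \<le> r 27"
    "queue m (r 27) ! (r 26 - 1) = (r 25, r 21)"
    using inv False by (auto simp: search_inv_def)
  have x: "(r 25, r 21) \<in> reach (det_of m0)"
    using search_inv_queue[OF inv, of "r 26 - 1"] i by simp
  then have s: "r 25 < N" using dst_reach by blast
  define d where "d = det_of m0 (r 25) (lab (st j))"
  obtain k where k: "k < M" "d = st k"
    using det_of_step[OF idx s j(3)] d_def by auto
  have "wp W (compare ;; IfNZ 8 (Const 0 0 ;; Const 7 0) push) (\<lambda>t. ?Q (Suc t)) r m"
  proof (rule wp_seqI[OF wp_compare[OF i(1) j(1) refl j(3) s i(2) d_def]])
    fix t1 :: nat and r1 m1
    assume "t1 = 15 \<and> m1 = m \<and> bases r1 \<and> r1 9 = dst (st j) \<and> r1 10 = d \<and>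
      (r1 8 = 0 \<longleftrightarrow> bits (st j) = bits d) \<and>
      r1 0 = r 0 \<and> r1 7 = r 7 \<and> r1 20 = st j \<and> r1 21 = r 21 \<and> r1 25 = r 25 \<and> r1 26 = r 26 \<and>
      r1 27 = r 27"
    then have 1: "t1 = 15" "m1 = m" "bases r1" "r1 9 = dst (st j)" "r1 10 = d"
      "r1 8 = 0 \<longleftrightarrow> bits (st j) = bits d"
      "r1 0 = 1" "r1 7 = 1" "r1 20 = st j" "r1 21 = r 21" "r1 25 = r 25" "r1 26 = r 26"
      "r1 27 = r 27"
      using r by auto
    show "wp W (IfNZ 8 (Const 0 0 ;; Const 7 0) push) (\<lambda>u. ?Q (Suc (t1 + u))) r1 m1"
    proof (cases "bits (st j) = bits d")
      case False
      \<comment> \<open>The early exit is sound: the queue holds only reachable pairs, so the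
        mismatch at the current one is a counterexample.\<close>
      then have "\<not> consistent (det_of m0)"
        using x j(2) unfolding consistent_def d_def by blast
      moreover have "0 < W" using W by simp
      ultimately show ?thesis using 1 False by simp
    next
      case True
      have "wp W push (\<lambda>u. ?Q (Suc (t1 + Suc u))) r1 m"
      proof (rule wp_mono[OF wp_push[OF 1(3,5,4,9) j(3) k dst_less[OF j(3)] i(2)]])
        show "queue_ok m (r1 27)" using i 1 by simp
      next
        fix t2 :: nat and r2 m2
        assume *: "t2 \<le> 20 \<and> bases r2 \<and>
          (if (dst d, dst (st j)) \<in> set (queue m (r1 27)) then m2 = m \<and> r2 27 = r1 27
           else m2 = enqueue (dst d) (dst (st j)) (r1 27) m \<and> r2 27 = r1 27 + 1) \<and>
          r2 20 = prev (src (st j)) (st j) \<and>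
          r2 0 = r1 0 \<and> r2 7 = r1 7 \<and> r2 21 = r1 21 \<and> r2 25 = r1 25 \<and> r2 26 = r1 26"
        have "search_inv r2 m2 \<and> Suc (pending r2 m2) = pending r m"
          by (rule search_inv_advance[OF inv j(1,2) d_def True]) (use * 1 j in simp_all)
        then show "?Q (Suc (t1 + Suc t2)) r2 m2" using * 1 by simp
      qed
      then show ?thesis using 1 True by simp
    qed
  qed
  then show ?thesis using False by (simp only: search_body_def wp_simps) simp
qed

lemma search_loop:
  assumes "search_inv r m" "r 7 = 1" "r 0 = 1"
  shows "wp W (While 7 search_body) (\<lambda>t r' m'. r' 0 = (if consistent (det_of m0) then 1 else 0) \<and>
    t \<le> Suc (50 * Suc (pending r m))) r m"
\<comment> \<open>The final round need not lower \<open>pending\<close>; the additional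
  \<open>Suc\<close> pays for it, and the measure drops to 0 with the loop register.\<close>
proof (rule wp_while[where \<Phi> = "\<lambda>r m. if r 7 = 0 then 0 else 50 * Suc (pending r m)" and
      I = "\<lambda>r' m'. r' 7 = 1 \<and> r' 0 = 1 \<and> search_inv r' m' \<or>
        r' 7 = 0 \<and> r' 0 = (if consistent (det_of m0) then 1 else 0)"], goal_cases)
  case 1
  then show ?case using assms by simp
next
  case (2 r m)
  then have *: "search_inv r m" "r 7 = 1" "r 0 = 1" by auto
  show ?case
    by (rule wp_mono[OF wp_search_body[OF *]]) (use * in auto)
next
  case (3 r' m' t)
  then show ?case using assms by auto
qed

end


section \<open>Correctness and running time of the whole program on well-formed inputs\<close>

definition is_det :: "(nat \<Rightarrow> nat \<Rightarrow> nat) \<Rightarrow> bool" where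
  "is_det d \<longleftrightarrow> (\<forall>s < N. \<forall>j < M. \<exists>k < M. d s (lab (st j)) = st k \<and> src (st k) = s \<and>
     lab (st k) = lab (st j))"

lemma index_ok_0: "index_ok inp 0"
proof -
  have 0: "inp (tab k x) = 0" if "0 < k" for k x
    using less_tab[OF _ that, of "B - 1" x] B_ge by (intro inp_0) simp
  have "trie inp (\<lambda>_. []) {0}"
    using B_ge by (simp add: trie_def 0)
  moreover have "{0} \<subseteq> {..<st 0}"
    using st_ge[of 0] by simp
  ultimately have "ids_ok inp 0"
    unfolding ids_ok_def by blast
  then show ?thesis
    using inp_less by (simp add: index_ok_def memory_ok_def det_ok_def lists_ok_def clean_def 0 prev_st_0)
qed

lemma wp_layout:
  assumes "r 2 = 1" "r 6 = B"
  shows "wp W layout (\<lambda>t r' m'. t = 10 \<and> m' = m \<and> bases r' \<and> r' 0 = r 0 \<and> r' 4 = r 4) r m"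
proof -
  have "B < W" "0 < W"
    using B_less_W B_ge by linarith+
  moreover have "B * B = tab 1 0" "tab 1 0 + tab 1 0 = tab 2 0" "tab 2 0 + tab 1 0 = tab 3 0"
    "tab 3 0 + tab 1 0 = tab 4 0" "tab 4 0 + tab 1 0 = tab 5 0" "tab 5 0 + tab 1 0 = tab 6 0"
    "tab 6 0 + tab 1 0 = tab 7 0" "tab 7 0 + tab 1 0 = tab 8 0"
    by (simp_all add: tab_def)
  moreover have "tab 1 0 < W" "tab 2 0 < W" "tab 3 0 < W" "tab 4 0 < W" "tab 5 0 < W"
    "tab 6 0 < W" "tab 7 0 < W" "tab 8 0 < W"
    using B_ge by (simp_all add: tab_less_W)
  ultimately show ?thesis
    unfolding layout_def using assms by (simp add: bases_def del: tab_add One_nat_def)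
qed

lemma wp_rewind:
  assumes "r 2 = 1" "r 4 = nI" "m 3 = M"
  shows "wp W rewind (\<lambda>t r' m'. t = 4 \<and> m' = m \<and> r' 6 = st 0 \<and> r' 7 = M \<and>
    (\<forall>k. k \<notin> {6, 7, 8} \<longrightarrow> r' k = r k)) r m"
proof -
  have "4 + nI < W" "M < W" "3 < W" "4 < W"
    using st_ge[of M] st_M B_less_W B_ge M_le_B by linarith+
  then show ?thesis
    using assms by (simp add: rewind_def st_0)
qed

lemma wp_init_setup:
  assumes "memory_ok m" "bases r"
  shows "wp W init_setup (\<lambda>t r' m'. t = 6 \<and> m' = m \<and> bases r' \<and> r' 0 = r 0 \<and> r' 7 = nI \<and>
    r' 24 = 4 \<and> r' 25 = inp 4 \<and> r' 26 = 0 \<and> r' 27 = 0) r m"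
proof -
  have "4 < B" using st_bound[of 0] st_0 M_pos by simp
  then have "4 < W" "2 < W" "0 < W" "m 4 = inp 4" "m 2 = nI" "inp 4 < W" "nI < W"
    using B_less_W memory_ok_inp[OF assms(1), of 4] memory_ok_inp[OF assms(1), of 2]
      inp_less[of 4] inp_less[of 2] unfolding nI_def by linarith+
  then show ?thesis
    using assms by (simp add: init_setup_def)
qed

lemma pending_start:
  assumes "r 20 = 0" "r 26 = 0"
  shows "pending r m \<le> 2 * n * n"
proof -
  have "(\<Sum>x \<in> {..<N} \<times> {..<N}. Suc (card (outs (snd x)))) =
      (\<Sum>s<N. \<Sum>p<N. Suc (card (outs p)))"
    unfolding sum.cartesian_product by (rule sum.cong) auto
  also have "\<dots> = N * (N + M)"
    by (simp add: sum_Suc sum_outs)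
  also have "\<dots> \<le> n * (n + n)"
    using N_le M_le by (intro mult_mono add_mono) auto
  finally show ?thesis
    using assms by (simp add: pending_def distrib_left)
qed

lemma wp_tidy_integral:
  assumes r: "r 2 = 1" "r 6 = B" "r 4 = nI" "r 0 = 1" and "integral"
  shows "wp W tidy_integral (\<lambda>t r' m'. t \<le> 80 + 170 * n + 120 * n * n \<and>
    (\<exists>d. is_det d \<and> r' 0 = (if consistent d then 1 else 0))) r inp"
    (is "wp W tidy_integral ?Q r inp")
  unfolding tidy_integral_def
proof (rule wp_seqI[OF wp_layout[OF r(1,2)]], rule wp_seqI[OF wp_rewind])
  fix t1 :: nat and r1 m1 assume "t1 = 10 \<and> m1 = inp \<and> bases r1 \<and> r1 0 = r 0 \<and> r1 4 = r 4"
  then show "r1 2 = 1" "r1 4 = nI" "m1 3 = M"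
    using r by (auto simp: bases_def M_def)
next
  fix t1 :: nat and r1 m1 and t2 :: nat and r2 m2
  assume 1: "t1 = 10 \<and> m1 = inp \<and> bases r1 \<and> r1 0 = r 0 \<and> r1 4 = r 4"
    and 2: "t2 = 4 \<and> m2 = m1 \<and> r2 6 = st 0 \<and> r2 7 = M \<and>
      (\<forall>k. k \<notin> {6, 7, 8} \<longrightarrow> r2 k = r1 k)"
  have "bases r2" "r2 0 = 1" "m2 = inp" "r2 6 = st 0" "r2 7 = M"
    using 1 2 r by (simp_all add: bases_def)
  note i = index_loop[OF assms(5) this(1,4,5,2) index_ok_0] this(3)
  show "wp W (While 7 index_body ;; init_setup ;; While 7 init_body ;; Const 20 0 ;; Const 7 1 ;;
      While 7 search_body) (\<lambda>t. ?Q (t1 + (t2 + t))) r2 m2"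
    unfolding i(2)
  proof (rule wp_seqI[OF i(1)])
    fix t3 :: nat and r3 m3 assume 3: "bases r3 \<and> r3 0 = 1 \<and> index_ok m3 M \<and> t3 \<le> Suc ((50 + 20 * n) * M)"
    then have idx: "index_ok m3 M" and m3: "memory_ok m3" "clean m3" and b3: "bases r3"
      by (auto simp: index_ok_def)
    show "wp W (init_setup ;; While 7 init_body ;; Const 20 0 ;; Const 7 1 ;;
      While 7 search_body) (\<lambda>t. ?Q (t1 + (t2 + (t3 + t)))) r3 m3"
    proof (rule wp_seqI[OF wp_init_setup[OF m3(1) b3]])
      fix t4 :: nat and r4 m4 assume 4: "t4 = 6 \<and> m4 = m3 \<and> bases r4 \<and> r4 0 = r3 0 \<and> r4 7 = nI \<and>
        r4 24 = 4 \<and> r4 25 = inp 4 \<and> r4 26 = 0 \<and> r4 27 = 0"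
      then have r4: "bases r4" "r4 0 = 1" "r4 7 = nI" "r4 24 = 4" "r4 25 = inp 4" "r4 26 = 0"
        "r4 27 = 0" and m4: "m4 = m3"
        using 3 by auto
      show "wp W (While 7 init_body ;; Const 20 0 ;; Const 7 1 ;;
        While 7 search_body) (\<lambda>t. ?Q (t1 + (t2 + (t3 + (t4 + t))))) r4 m4"
        unfolding m4
      proof (rule wp_seqI[OF init_loop[OF m3 r4]])
        fix t5 :: nat and r5 m5
        assume 5: "bases r5 \<and> r5 0 = 1 \<and> r5 26 = 0 \<and> r5 27 = nI \<and> same_index m3 m5 \<and>
          queue_ok m5 nI \<and> queue m5 nI = init_pairs nI \<and> t5 \<le> Suc (20 * nI)"
        let ?r = "r5(20 := 0, 7 := 1)"
        have "set (init_pairs nI) \<subseteq> reach (det_of m3)"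
          by (auto simp: init_pairs_def intro: reach_init)
        then have inv: "search_inv m3 ?r m5"
          using 5 by (simp add: search_inv_def[OF idx])
        have det: "is_det (det_of m3)"
          using det_of_step[OF idx] by (simp add: is_det_def)
        have p: "pending ?r m5 \<le> 2 * n * n"
          by (rule pending_start) (use 5 in auto)
        have "(50 + 20 * n) * M \<le> 50 * n + 20 * n * n"
          using mult_le_mono2[OF M_le, of "50 + 20 * n"] by (simp add: algebra_simps)
        \<comment> \<open>The quadratic term is \<open>20 * n * n\<close> for the trie walks,
          \<open>n\<close> digits for each of at most \<open>n\<close> transitions, plus
          \<open>50 * (2 * n * n)\<close> for the search.\<close>
        then have time: "t1 + (t2 + (t3 + (t4 + (t5 + (1 + (1 + t)))))) \<le> 80 + 170 * n + 120 * n * n"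
          if "t \<le> Suc (50 * Suc (pending ?r m5))" for t
          using 1 2 3 4 5 p that nI_le by simp
        have "wp W (While 7 search_body) (\<lambda>t r' m'.
            ?Q (t1 + (t2 + (t3 + (t4 + (t5 + (1 + (1 + t))))))) r' m') ?r m5"
          by (rule wp_mono[OF search_loop[OF idx inv]]) (use 5 det time in auto)
        moreover have "1 < W" "0 < W" using W B_ge B_less_W by auto
        ultimately show "wp W (Const 20 0 ;; Const 7 1 ;;
          While 7 search_body) (\<lambda>t. ?Q (t1 + (t2 + (t3 + (t4 + (t5 + t)))))) r5 m5"
          by (simp only: wp_simps)
      qed
    qed
  qed
qed

text \<open>The choice made by the program depends on the order of the input, so \<open>d\<close> is
  existential here; \<open>tidy_iff\<close> yields the same verdict for every \<open>d\<close> with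
  \<open>is_det\<close>.\<close>

lemma tidy_program_correct:
  "wp W tidy_program (\<lambda>t r m. t \<le> 100 + 200 * n + 120 * n * n \<and>
     (\<exists>d. is_det d \<and> r 0 = (if integral \<and> consistent d then 1 else 0))) (\<lambda>_. 0) inp"
proof -
  let ?Q = "\<lambda>(t::nat) r (m::nat\<Rightarrow>nat). t \<le> 100 + 200 * n + 120 * n * n \<and>
     (\<exists>d. is_det d \<and> r 0 = (if integral \<and> consistent d then 1 else 0))"
  have B: "1 < W" "3 < W" "M < W" "M \<noteq> 0" "2 < W" "nI < W"
    using B_less_W B_ge M_le_B M_pos inp_less[of 2] unfolding nI_def by linarith+
  \<comment> \<open>If the input is not integral, no table is built, yet some \<open>d\<close> must
    be exhibited; completeness provides one by choice.\<close>
  have ex: "\<exists>d. is_det d"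
  proof
    let ?P = "\<lambda>s a e. \<exists>k < M. e = st k \<and> src e = s \<and> lab e = a"
    have "?P s (lab (st j)) (SOME e. ?P s (lab (st j)) e)" if "s < N" "j < M" for s j
      by (rule someI_ex) (use complete[OF that] in blast)
    then show "is_det (\<lambda>s a. SOME e. ?P s a e)"
      unfolding is_det_def by fastforce
  qed
  let ?r = "(\<lambda>_ :: nat. 0 :: nat)(2 := 1, 3 := M, 0 := 1, 8 := 2, 4 := nI)"
  have "wp W (rewind ;; While 7 scan_body ;; IfNZ 0 tidy_integral Skip) (\<lambda>t. ?Q (7 + t)) ?r inp"
  proof (rule wp_seqI[OF wp_rewind])
    fix t1 :: nat and r1 :: "nat \<Rightarrow> nat" and m1
    assume "t1 = 4 \<and> m1 = inp \<and> r1 6 = st 0 \<and> r1 7 = M \<and> (\<forall>k. k \<notin> {6, 7, 8} \<longrightarrow> r1 k = ?r k)"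
    then have 1: "t1 = 4" "m1 = inp" "r1 6 = 4 + nI" "r1 7 = M" "r1 2 = 1" "r1 0 = 1" "r1 4 = nI"
      using st_0 by simp_all
    show "wp W (While 7 scan_body ;; IfNZ 0 tidy_integral Skip) (\<lambda>t. ?Q (7 + (t1 + t))) r1 m1"
      unfolding 1(2)
    proof (rule wp_seqI[OF scan[OF 1(5,6,3,4)]])
      fix t2 :: nat and r2 :: "nat \<Rightarrow> nat" and m2 :: "nat \<Rightarrow> nat"
      assume 2: "m2 = inp \<and> r2 2 = 1 \<and> r2 6 = B \<and> r2 4 = r1 4 \<and>
        r2 0 = (if integral then 1 else 0) \<and> t2 \<le> Suc (30 * M)"
      show "wp W (IfNZ 0 tidy_integral Skip) (\<lambda>t. ?Q (7 + (t1 + (t2 + t)))) r2 m2"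
      proof (cases integral)
        case True
        have "wp W tidy_integral (\<lambda>t. ?Q (7 + (t1 + (t2 + Suc t)))) r2 inp"
          by (rule wp_mono[OF wp_tidy_integral]) (use 1 2 True M_le in auto)
        then show ?thesis using 2 True by simp
      next
        case False
        then show ?thesis using 1 2 ex M_le by simp
      qed
    qed
  qed (simp_all add: M_def)
  then show ?thesis
    using B by (simp add: tidy_program_def M_def[symmetric] nI_def[symmetric] del: One_nat_def)
qed

end

section \<open>Binary digits of numerators and denominators\<close>

lemma binary_eq: "binary n = (if n < 2 then [n] else binary (n div 2) @ [n mod 2])"
  by (rule binary.simps)

lemma binary_not_Nil [simp]: "binary n \<noteq> []" "[] \<noteq> binary n"
  by (subst binary_eq, simp)+

lemma binary_digit_less: "x \<in> set (binary n) \<Longrightarrow> x < 2"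
proof (induction n rule: less_induct)
  case (less n)
  show ?case
  proof (cases "n < 2")
    case True
    then show ?thesis using less.prems by (simp add: binary_eq[of n])
  next
    case False
    then have "x \<in> set (binary (n div 2)) \<or> x = n mod 2"
      using less.prems by (auto simp: binary_eq[of n])
    then show ?thesis using less.IH[of "n div 2"] False by auto
  qed
qed

lemma binary_inj: "binary m = binary n \<Longrightarrow> m = n"
proof (induction m arbitrary: n rule: less_induct)
  case (less m)
  show ?case
  proof (cases "m < 2")
    case True
    then have m: "binary m = [m]" by (subst binary_eq) simp
    then have "n < 2"
      using less.prems binary_not_Nil[of "n div 2"]
      by (cases "n < 2") (auto simp: binary_eq[of n])
    then show ?thesis using m less.prems by (simp add: binary_eq[of n])
  next
    case False
    then have m: "binary m = binary (m div 2) @ [m mod 2]" by (subst binary_eq) simp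
    then have "\<not> n < 2"
      using less.prems by (auto simp: binary_eq[of n])
    then have "binary (m div 2) = binary (n div 2)" "m mod 2 = n mod 2"
      using m less.prems by (simp_all add: binary_eq[of n])
    then have "m div 2 = n div 2"
      using less.IH[of "m div 2"] False by simp
    then show ?thesis
      using \<open>m mod 2 = n mod 2\<close> by (metis div_mult_mod_eq)
  qed
qed

lemma length_binary_eq_1: "length (binary n) = 1 \<longleftrightarrow> n < 2"
  by (subst binary_eq) auto

definition num_bits :: "rat \<Rightarrow> nat list" where
  "num_bits r = binary (nat \<bar>fst (quotient_of r)\<bar>)"

definition den_bits :: "rat \<Rightarrow> nat list" where
  "den_bits r = binary (nat (snd (quotient_of r)))"

lemma rat_code_eq:
  "rat_code r = (if fst (quotient_of r) < 0 then 1 else 0) #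
     length (num_bits r) # num_bits r @ length (den_bits r) # den_bits r"
  by (simp add: rat_code_def nat_code_def num_bits_def den_bits_def split: prod.split)

lemma binary_length_eq: "binary_length r = length (num_bits r) + length (den_bits r)"
  by (simp add: binary_length_def num_bits_def den_bits_def split: prod.split)

lemma den_bits_Ints: "length (den_bits r) = 1 \<longleftrightarrow> r \<in> \<int>"
proof -
  obtain p q where r: "quotient_of r = (p, q)" by fastforce
  then have q: "0 < q" by (rule quotient_of_denom_pos)
  have "length (den_bits r) = 1 \<longleftrightarrow> q = 1"
    using q unfolding den_bits_def length_binary_eq_1 r by auto
  also have "\<dots> \<longleftrightarrow> r \<in> \<int>"
  proof
    assume "q = 1"
    then show "r \<in> \<int>" using quotient_of_div[OF r] by simp
  next
    assume "r \<in> \<int>"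
    then obtain z where "r = of_int z" by (elim Ints_cases)
    then show "q = 1" using r by simp
  qed
  finally show ?thesis .
qed

text \<open>This justifies a trie over numerators alone: for positive integers, sign and denominator
  carry no information.\<close>

lemma num_bits_inj:
  assumes "r \<in> \<int>" "s \<in> \<int>" "0 < r" "0 < s" "num_bits r = num_bits s"
  shows "r = s"
proof -
  obtain x y where xy: "r = of_int x" "s = of_int y"
    using assms(1,2) by (elim Ints_cases)
  then have "0 < x" "0 < y" using assms(3,4) by simp_all
  moreover have "nat \<bar>x\<bar> = nat \<bar>y\<bar>"
    using binary_inj[of "nat \<bar>x\<bar>"] assms(5) xy by (simp add: num_bits_def)
  ultimately show ?thesis using xy by simp
qed

section \<open>Runs and encoded automata\<close>

lemma is_run_snoc:
  assumes "is_run A u qs" "(last qs, a, q) \<in> trans A"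
  shows "is_run A (u @ [a]) (qs @ [q])"
proof -
  have len: "length qs = Suc (length u)"
    using assms(1) by (simp add: is_run_def)
  then have "last qs = qs ! length u"
    by (cases "qs = []") (simp_all add: last_conv_nth)
  then show ?thesis
    using assms by (auto simp: is_run_def nth_append less_Suc_eq)
qed

lemma is_run_snocE:
  assumes "is_run A (u @ [a]) qs"
  obtains qs' q where "qs = qs' @ [q]" "is_run A u qs'" "(last qs', a, q) \<in> trans A"
proof (cases qs rule: rev_cases)
  case Nil
  then show ?thesis using assms by (simp add: is_run_def)
next
  case (snoc qs' q)
  then have len: "length qs' = Suc (length u)"
    using assms by (simp add: is_run_def)
  have tr: "(qs ! i, (u @ [a]) ! i, qs ! Suc i) \<in> trans A" if "i \<le> length u" for i
    using assms that by (simp add: is_run_def)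
  have "is_run A u qs'"
    unfolding is_run_def
  proof (intro conjI allI impI)
    show "qs' ! 0 \<in> init A"
      using assms snoc len by (auto simp: is_run_def nth_append)
    show "(qs' ! i, u ! i, qs' ! Suc i) \<in> trans A" if "i < length u" for i
      using tr[of i] that snoc len by (simp add: nth_append)
  qed (rule len)
  moreover have "last qs' = qs' ! length u"
    using len by (cases "qs' = []") (simp_all add: last_conv_nth)
  then have "(last qs', a, q) \<in> trans A"
    using tr[of "length u"] snoc len by (simp add: nth_append)
  ultimately show ?thesis using that snoc by blast
qed

definition last_discount :: "('a, 'q) nmda \<Rightarrow> 'a list \<Rightarrow> 'q list \<Rightarrow> rat" where
  "last_discount A u qs = discount A (qs ! (length u - 1), u ! (length u - 1), qs ! length u)"

lemma last_discount_snoc: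
  assumes "is_run A u qs"
  shows "last_discount A (u @ [a]) (qs @ [q]) = discount A (last qs, a, q)"
proof -
  have len: "length qs = Suc (length u)"
    using assms by (simp add: is_run_def)
  then have "last qs = qs ! length u"
    by (cases "qs = []") (simp_all add: last_conv_nth)
  then show ?thesis using len by (simp add: last_discount_def nth_append)
qed

text \<open>Fixes the numberings and listings that \<open>nmda_code\<close> quantifies
  existentially. Automata without transitions are left to the final proof, since
  \<open>word_input\<close> assumes \<open>0 < M\<close>.\<close>

locale coded_nmda =
  fixes A :: "('a, 'q) nmda" and f :: "'q \<Rightarrow> nat" and g :: "'a \<Rightarrow> nat"
    and qs :: "'q list" and es :: "('q \<times> 'a \<times> 'q) list"
  assumes nmda: "is_nmda A"
    and f: "bij_betw f (states A) {..<card (states A)}"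
    and g: "bij_betw g (alphabet A) {..<card (alphabet A)}"
    and qs: "distinct qs" "set qs = init A"
    and es: "distinct es" "set es = trans A"
    and trans_ne: "trans A \<noteq> {}"
begin

definition enc :: "'q \<times> 'a \<times> 'q \<Rightarrow> nat list" where
  "enc e = (case e of (p, a, q) \<Rightarrow> [f p, g a, f q] @ rat_code (weight A e) @ rat_code (discount A e))"

definition code :: "nat list" where
  "code = [card (states A), card (alphabet A), card (init A), card (trans A)] @ map f qs @
     concat (map enc es)"

definition inp :: "nat \<Rightarrow> nat" where
  "inp i = (if i < length code then code ! i else 0)"

definition start :: "nat \<Rightarrow> nat" where
  "start i = 4 + card (init A) + length (concat (map enc (take i es)))"

lemma fin: "finite (states A)" "finite (alphabet A)" "finite (trans A)" "finite (init A)"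
  using nmda es by (auto simp: is_nmda_def intro: finite_subset)

lemma lengths: "length es = card (trans A)" "length qs = card (init A)"
  using es qs distinct_card by fastforce+

lemma transD: "(p, a, q) \<in> trans A \<Longrightarrow> p \<in> states A \<and> a \<in> alphabet A \<and> q \<in> states A"
  using nmda by (auto simp: is_nmda_def)

lemma init_states: "q \<in> init A \<Longrightarrow> q \<in> states A"
  using nmda by (auto simp: is_nmda_def)

lemma f_less: "q \<in> states A \<Longrightarrow> f q < card (states A)"
  using f by (auto simp: bij_betw_def)

lemma g_less: "a \<in> alphabet A \<Longrightarrow> g a < card (alphabet A)"
  using g by (auto simp: bij_betw_def)

lemma f_eq_iff: "p \<in> states A \<Longrightarrow> q \<in> states A \<Longrightarrow> f p = f q \<longleftrightarrow> p = q"
  using f by (auto simp: bij_betw_def dest: inj_onD)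

lemma g_eq_iff: "a \<in> alphabet A \<Longrightarrow> b \<in> alphabet A \<Longrightarrow> g a = g b \<longleftrightarrow> a = b"
  using g by (auto simp: bij_betw_def dest: inj_onD)

lemma total: "p \<in> states A \<Longrightarrow> a \<in> alphabet A \<Longrightarrow> \<exists>q. (p, a, q) \<in> trans A"
  using nmda by (auto simp: is_nmda_def)

text \<open>By completeness the transitions map onto the pairs of state and letter. This is how a
  size that counts transitions controls the numbers of states and letters.\<close>

lemma card_product_le: "card (states A) * card (alphabet A) \<le> card (trans A)"
proof -
  have "states A \<times> alphabet A \<subseteq> (\<lambda>(p, a, q). (p, a)) ` trans A"
    using total by force
  then have "card (states A \<times> alphabet A) \<le> card (trans A)"
    using fin surj_card_le by blast
  then show ?thesis by (simp add: card_cartesian_product)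
qed

lemma card_le: "card (states A) \<le> card (trans A)" "card (alphabet A) \<le> card (trans A)"
  "card (init A) \<le> card (states A)" "0 < card (trans A)"
proof -
  obtain p a q where "(p, a, q) \<in> trans A" using trans_ne by auto
  then have "0 < card (states A)" "0 < card (alphabet A)"
    using transD fin by (auto simp: card_gt_0_iff)
  then have "card (states A) \<le> card (states A) * card (alphabet A)"
    "card (alphabet A) \<le> card (states A) * card (alphabet A)"
    by simp_all
  then show "card (states A) \<le> card (trans A)" "card (alphabet A) \<le> card (trans A)"
    using card_product_le by linarith+
  show "card (init A) \<le> card (states A)"
    using fin init_states by (intro card_mono) auto
  show "0 < card (trans A)" using trans_ne fin by (simp add: card_gt_0_iff)
qed

lemma length_code: "length code = start (length es)"
  by (simp add: code_def start_def lengths)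

lemma start_Suc: "i < length es \<Longrightarrow> start (Suc i) = start i + length (enc (es ! i))"
  by (simp add: start_def take_Suc_conv_app_nth)

lemma inp_enc:
  assumes "i < length es" "j < length (enc (es ! i))"
  shows "inp (start i + j) = enc (es ! i) ! j"
proof -
  let ?pre = "[card (states A), card (alphabet A), card (init A), card (trans A)] @ map f qs @
    concat (map enc (take i es))"
  have "es = take i es @ es ! i # drop (Suc i) es"
    using assms(1) by (rule id_take_nth_drop)
  then have "concat (map enc es) =
      concat (map enc (take i es)) @ enc (es ! i) @ concat (map enc (drop (Suc i) es))"
    by (metis concat.simps(2) concat_append list.simps(9) map_append)
  then have c: "code = ?pre @ enc (es ! i) @ concat (map enc (drop (Suc i) es))"
    by (simp add: code_def)
  have l: "length ?pre = start i"
    by (simp add: start_def lengths)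
  have "start i + j < length code"
    using assms(2) l unfolding c length_append by linarith
  moreover have "code ! (start i + j) = enc (es ! i) ! j"
    unfolding c l[symmetric] using assms(2) by (simp only: nth_append_length_plus nth_append) simp
  ultimately show ?thesis by (simp add: inp_def)
qed

lemma inp_header: "inp 2 = card (init A)" "inp 3 = card (trans A)"
  by (simp_all add: inp_def code_def numeral_3_eq_3 numeral_2_eq_2)

lemma inp_init: "i < card (init A) \<Longrightarrow> inp (4 + i) = f (qs ! i)"
  by (simp add: inp_def code_def nth_append lengths eval_nat_numeral)

text \<open>Digits are below 2, a digit count is smaller than the block of words containing it, and
  state and letter numbers are bounded by the number of transitions, each of which contributes at
  least one word.\<close>

lemma code_less: "x \<in> set code \<Longrightarrow> x < length code"
proof -
  have len: "4 + card (init A) + length (concat (map enc es)) = length code"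
    by (simp add: code_def lengths)
  have len_enc: "1 \<le> length (enc e)" for e
    by (simp add: enc_def rat_code_eq split: prod.split)
  then have "sum_list (map (\<lambda>_. 1) es) \<le> sum_list (map (\<lambda>e. length (enc e)) es)"
    by (intro sum_list_mono)
  then have M: "card (trans A) < length code"
    using len by (simp add: length_concat comp_def lengths[symmetric] sum_list_triv)
  have rat: "x < length (rat_code r)" if "x \<in> set (rat_code r)" for r
    using that binary_digit_less[of x] by (auto simp: rat_code_eq num_bits_def den_bits_def)
      fastforce+
  assume "x \<in> set code"
  then consider "x \<in> {card (states A), card (alphabet A), card (init A), card (trans A)}"
    | "x \<in> f ` init A" | e where "e \<in> set es" "x \<in> set (enc e)"
    using qs by (auto simp: code_def)
  then show "x < length code"
  proof cases
    case 1
    then show ?thesis using M card_le by auto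
  next
    case 2
    then have "x < card (states A)" using f_less init_states by auto
    then show ?thesis using M card_le by simp
  next
    case 3
    obtain p a q where e: "e = (p, a, q)" by (cases e)
    have s: "p \<in> states A" "a \<in> alphabet A" "q \<in> states A"
      using 3 e transD es by auto
    have "x < card (trans A) \<or> x < length (enc e)"
      using 3(2) rat[of "weight A e"] rat[of "discount A e"] f_less[OF s(1)] f_less[OF s(3)]
        g_less[OF s(2)] card_le
      by (fastforce simp: enc_def e)
    moreover have "length (enc e) \<le> length code"
      using 3(1) len by (auto simp: length_concat dest!: split_list)
    ultimately show ?thesis using M by auto
  qed
qed

lemma inp_less: "inp x < length code"
  using code_less[OF nth_mem, of x] length_code by (auto simp: inp_def start_def)

text \<open>These repeat the \<open>defines\<close> clauses of \<open>word_input\<close> for the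
  concrete input, so that its parameters can be instantiated and its assumptions proved
  beforehand.\<close>

definition "src e = inp e"
definition "lab e = inp (e + 1)"
definition "dst e = inp (e + 2)"
definition "after_num x = x + inp x + 1"
definition "cnt e = after_num (after_num (e + 4)) + 1"
definition "dn e = inp (cnt e)"
definition "digs e = cnt e + 1"
definition "den e = after_num (cnt e)"
definition "nI = inp 2"
definition "M = inp 3"

lemma M_eq: "M = card (trans A)" "M = length es" and nI_eq: "nI = card (init A)"
  by (simp_all add: M_def nI_def inp_header lengths)

lemma fields:
  assumes "i < M" "es ! i = (p, a, q)"
  shows "src (start i) = f p" "lab (start i) = g a" "dst (start i) = f q"
    "(p, a, q) \<in> trans A"
proof -
  have i: "i < length es" using assms M_eq by simp
  have e: "enc (es ! i) = f p # g a # f q # rat_code (weight A (es ! i)) @ rat_code (discount A (es ! i))"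
    by (simp add: enc_def assms(2))
  show "src (start i) = f p" "lab (start i) = g a" "dst (start i) = f q"
    using inp_enc[OF i, of 0] inp_enc[OF i, of 1] inp_enc[OF i, of 2]
    by (simp_all add: e src_def lab_def dst_def)
  show "(p, a, q) \<in> trans A"
    using nth_mem[OF i] es assms(2) by simp
qed

lemma numbers:
  assumes "i < M" and d: "d = num_bits (discount A (es ! i))" "u = den_bits (discount A (es ! i))"
  shows "dn (start i) = length d" "j < length d \<Longrightarrow> inp (digs (start i) + j) = d ! j"
    "inp (den (start i)) = length u" "den (start i) = digs (start i) + length d"
    "start (Suc i) = after_num (den (start i))"
proof -
  have i: "i < length es" using assms M_eq by simp
  define w v where "w = num_bits (weight A (es ! i))" and "v = den_bits (weight A (es ! i))"
  obtain p a q where "es ! i = (p, a, q)" by (cases "es ! i")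
  then have "enc (es ! i) =
      [f p, g a, f q, (if fst (quotient_of (weight A (es ! i))) < 0 then 1 else 0), length w] @ w @
      [length v] @ v @ [(if fst (quotient_of (discount A (es ! i))) < 0 then 1 else 0), length d] @
      d @ [length u] @ u"
    by (simp add: enc_def rat_code_eq w_def v_def d)
  then obtain x0 x1 x2 x3 x4 where e: "enc (es ! i) =
      [x0, x1, x2, x3, length w] @ w @ [length v] @ v @ [x4, length d] @ d @ [length u] @ u"
    by blast
  have nth: "inp (start i + k) = x" if "enc (es ! i) = l @ x # l'" "k = length l" for l x l' k
    using inp_enc[OF i, of "length l"] that by simp
  have 1: "inp (start i + 4) = length w"
    by (rule nth[of "[x0, x1, x2, x3]"]) (simp_all add: e)
  have 2: "inp (start i + (5 + length w)) = length v"
    by (rule nth[of "[x0, x1, x2, x3, length w] @ w"]) (simp_all add: e)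
  have 3: "inp (start i + (7 + length w + length v)) = length d"
    by (rule nth[of "[x0, x1, x2, x3, length w] @ w @ [length v] @ v @ [x4]"]) (simp_all add: e)
  have 4: "inp (start i + (8 + length w + length v + length d)) = length u"
    by (rule nth[of "[x0, x1, x2, x3, length w] @ w @ [length v] @ v @ [x4, length d] @ d"])
      (simp_all add: e)
  have 5: "inp (start i + (8 + length w + length v + j)) = d ! j" if "j < length d" for j
  proof (rule nth)
    have "d = take j d @ d ! j # drop (Suc j) d"
      using that by (rule id_take_nth_drop)
    then show "enc (es ! i) = ([x0, x1, x2, x3, length w] @ w @ [length v] @ v @ [x4, length d] @
        take j d) @ d ! j # (drop (Suc j) d @ [length u] @ u)"
      unfolding e by (metis append.assoc append_Cons)
  qed (use that in simp)
  note num = 2 [folded add.assoc] 3 [folded add.assoc] 4 [folded add.assoc] 5 [folded add.assoc]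
  have a: "after_num (start i + 4) = start i + 5 + length w"
    using 1 by (simp add: after_num_def)
  have c: "cnt (start i) = start i + 7 + length w + length v"
    unfolding cnt_def a using num(1) by (simp add: after_num_def)
  show "dn (start i) = length d" using num(2) by (simp add: dn_def c)
  have g: "digs (start i) = start i + 8 + length w + length v" by (simp add: digs_def c)
  then show "j < length d \<Longrightarrow> inp (digs (start i) + j) = d ! j" using num(4) by simp
  have n: "den (start i) = start i + 8 + length w + length v + length d"
    unfolding den_def after_num_def c using num(2) by simp
  then show "den (start i) = digs (start i) + length d" using g by simp
  show "inp (den (start i)) = length u" using num(3) n by simp
  then show "start (Suc i) = after_num (den (start i))"
    using n by (simp add: after_num_def start_Suc[OF i] e)
qed

lemma size_bounds:
  "card (trans A) \<le> nmda_size A"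
  "e \<in> trans A \<Longrightarrow> binary_length (weight A e) \<le> nmda_size A"
  "e \<in> trans A \<Longrightarrow> binary_length (discount A e) \<le> nmda_size A"
  using fin unfolding nmda_size_def by (intro Max_ge; simp)+

lemma length_code_le: "length code \<le> 4 * (nmda_size A + 2) ^ 2"
proof -
  define n where "n = nmda_size A"
  have "length (enc e) \<le> 9 + 2 * n" if "e \<in> set es" for e
    using size_bounds(2,3)[of e] that es
    by (cases e) (simp add: enc_def rat_code_eq binary_length_eq n_def)
  then have "sum_list (map (length \<circ> enc) es) \<le> sum_list (map (\<lambda>_. 9 + 2 * n) es)"
    by (intro sum_list_mono) simp
  also have "\<dots> = card (trans A) * (9 + 2 * n)"
    by (simp add: sum_list_triv lengths)
  also have "\<dots> \<le> n * (9 + 2 * n)"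
    using size_bounds(1) by (simp add: n_def)
  finally have "length code \<le> 4 + n + n * (9 + 2 * n)"
    using card_le size_bounds(1) by (simp add: code_def length_concat lengths n_def)
  also have "\<dots> \<le> 4 * (n + 2) ^ 2"
    by (simp add: power2_eq_square algebra_simps)
  finally show ?thesis by (simp add: n_def)
qed

text \<open>The origin of the exponent 9: the squared code length takes four factors
  \<open>k\<close>, and five more absorb the constant, as \<open>160 < 3 ^ 5\<close> and a
  transition forces \<open>3 \<le> k\<close>.\<close>

lemma word_size: "10 * (length code * length code) < (nmda_size A + 2) ^ 9"
proof -
  define k where "k = nmda_size A + 2"
  have k: "3 \<le> k"
    using size_bounds(1) card_le by (simp add: k_def)
  have "10 * (length code * length code) \<le> 10 * (4 * k ^ 2 * (4 * k ^ 2))"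
    using length_code_le by (intro mult_le_mono) (simp_all add: k_def)
  also have "\<dots> = 160 * k ^ 4"
    by (simp add: power2_eq_square power4_eq_xxxx)
  also have "\<dots> < 3 ^ 5 * k ^ 4"
    using k by simp
  also have "\<dots> \<le> k ^ 5 * k ^ 4"
    using k by (intro mult_le_mono1 power_mono) auto
  also have "\<dots> = k ^ 9"
    by (simp flip: power_add)
  finally show ?thesis by (simp add: k_def)
qed

lemma trans_index:
  assumes "e \<in> trans A"
  obtains i where "i < M" "es ! i = e"
proof -
  have "e \<in> set es" using assms es by simp
  then show ?thesis using that by (auto simp: in_set_conv_nth M_eq(2))
qed

lemma index_trans: "i < M \<Longrightarrow> es ! i \<in> trans A"
  using es nth_mem by (auto simp: M_eq(2))

lemma word_facts:
  "0 < M" "M \<le> nmda_size A" "card (states A) \<le> M" "nI \<le> nmda_size A"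
  "start 0 = 4 + nI"
  "i < M \<Longrightarrow> start (Suc i) = after_num (den (start i))"
  "start M = length code"
  "length code \<le> x \<Longrightarrow> inp x = 0"
  "i < nI \<Longrightarrow> inp (4 + i) < card (states A)"
  "inj_on (\<lambda>i. inp (4 + i)) {..<nI}"
  "i < M \<Longrightarrow> src (start i) < card (states A)"
  "i < M \<Longrightarrow> dst (start i) < card (states A)"
  "i < M \<Longrightarrow> j < dn (start i) \<Longrightarrow> inp (digs (start i) + j) < 2"
  "i < M \<Longrightarrow> 0 < inp (den (start i))"
  "i < M \<Longrightarrow> dn (start i) \<le> nmda_size A"
  "s < card (states A) \<Longrightarrow> i < M \<Longrightarrow> \<exists>j < M. src (start j) = s \<and> lab (start j) = lab (start i)"
proof -
  show "0 < M" "M \<le> nmda_size A" "card (states A) \<le> M" "nI \<le> nmda_size A"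
    using card_le size_bounds(1) by (auto simp: M_eq nI_eq)
  show "start 0 = 4 + nI" by (simp add: start_def nI_eq)
  show "start M = length code" by (simp add: length_code M_eq(2))
  show "start (Suc i) = after_num (den (start i))" if "i < M" for i
    using numbers(5)[OF that refl refl] .
  show "inp x = 0" if "length code \<le> x" for x using that by (simp add: inp_def)
  have qi: "qs ! i \<in> states A" if "i < nI" for i
    using that qs init_states nth_mem[of i qs] by (simp add: nI_eq lengths)
  show "inp (4 + i) < card (states A)" if "i < nI" for i
    using that qi f_less by (simp add: nI_eq inp_init)
  show "inj_on (\<lambda>i. inp (4 + i)) {..<nI}"
  proof (rule inj_onI)
    fix i j assume ij: "i \<in> {..<nI}" "j \<in> {..<nI}" "inp (4 + i) = inp (4 + j)"
    then have "qs ! i = qs ! j"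
      using qi f_eq_iff by (simp add: nI_eq inp_init)
    then show "i = j"
      using ij qs(1) by (simp add: nth_eq_iff_index_eq nI_eq lengths)
  qed
  show "src (start i) < card (states A)" "dst (start i) < card (states A)" if "i < M" for i
  proof -
    obtain p a q where "es ! i = (p, a, q)" by (cases "es ! i")
    then show "src (start i) < card (states A)" "dst (start i) < card (states A)"
      using fields[OF that] transD f_less by auto
  qed
  show "inp (digs (start i) + j) < 2" if "i < M" "j < dn (start i)" for i j
    using numbers(1,2)[OF that(1) refl refl] that(2) binary_digit_less nth_mem
    by (metis num_bits_def)
  show "0 < inp (den (start i))" if "i < M" for i
    using numbers(3)[OF that refl refl] by (simp add: den_bits_def)
  show "dn (start i) \<le> nmda_size A" if "i < M" for i
    using numbers(1)[OF that refl refl] size_bounds(3)[of "es ! i"] es nth_mem[of i es] that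
    by (simp add: binary_length_eq M_eq(1) lengths)
  show "\<exists>j < M. src (start j) = s \<and> lab (start j) = lab (start i)"
    if s: "s < card (states A)" and i: "i < M" for s i
  proof -
    obtain p a q where e: "es ! i = (p, a, q)" by (cases "es ! i")
    note fi = fields[OF i e]
    have "s \<in> f ` states A"
      using s f by (simp add: bij_betw_def)
    then obtain s' where s': "s' \<in> states A" "f s' = s"
      by blast
    obtain t where "(s', a, t) \<in> trans A"
      using total[OF s'(1)] transD[OF fi(4)] by blast
    then obtain j where j: "j < M" "es ! j = (s', a, t)"
      by (rule trans_index)
    then show ?thesis using fields[OF j] fi s' by auto
  qed
qed

sublocale word_input inp "(nmda_size A + 2) ^ 9" "length code" "card (states A)" "nmda_size A" start
  src lab dst after_num cnt dn den digs M nI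
  by unfold_locales
    (fact word_size inp_less
      word_facts[unfolded src_def lab_def dst_def after_num_def cnt_def dn_def digs_def den_def nI_def M_def]
     | simp add: src_def lab_def dst_def after_num_def cnt_def dn_def digs_def den_def nI_def M_def)+


lemma bits_start: "i < M \<Longrightarrow> bits (start i) = num_bits (discount A (es ! i))"
  using numbers(1,2,4)[OF _ refl refl, of i] unfolding bits_def
  by (intro nth_equalityI) auto

lemma integral_iff: "integral \<longleftrightarrow> integral_nmda A"
proof -
  have "inp (den (start i)) = 1 \<longleftrightarrow> discount A (es ! i) \<in> \<int>" if "i < M" for i
    by (simp only: numbers(3)[OF that refl refl] den_bits_Ints)
  then have "integral \<longleftrightarrow> (\<forall>i < M. discount A (es ! i) \<in> \<int>)"
    unfolding integral_def by blast
  also have "\<dots> \<longleftrightarrow> integral_nmda A"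
    unfolding integral_nmda_def
  proof (intro iffI allI ballI impI)
    fix e assume "\<forall>i < M. discount A (es ! i) \<in> \<int>" "e \<in> trans A"
    moreover obtain i where "i < M" "es ! i = e"
      by (rule trans_index[OF \<open>e \<in> trans A\<close>])
    ultimately show "discount A e \<in> \<int>" by blast
  qed (use index_trans in blast)
  finally show ?thesis .
qed

lemma bits_eq_iff:
  assumes "integral" "i < M" "j < M"
  shows "bits (start i) = bits (start j) \<longleftrightarrow> discount A (es ! i) = discount A (es ! j)"
proof -
  have pos: "discount A e \<in> \<int> \<and> 0 < discount A e" if "e \<in> trans A" for e
    using that assms(1) nmda unfolding integral_iff integral_nmda_def is_nmda_def
    by (auto intro: less_trans[OF zero_less_one])
  have "num_bits (discount A (es ! i)) = num_bits (discount A (es ! j)) \<longleftrightarrow>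
      discount A (es ! i) = discount A (es ! j)"
  proof
    assume "num_bits (discount A (es ! i)) = num_bits (discount A (es ! j))"
    with pos[OF index_trans[OF assms(2)]] pos[OF index_trans[OF assms(3)]]
    show "discount A (es ! i) = discount A (es ! j)"
      by (auto intro: num_bits_inj)
  qed simp
  then show ?thesis
    by (simp only: bits_start[OF assms(2)] bits_start[OF assms(3)])
qed

section \<open>Reachable pairs correspond to pairs of runs on a common word\<close>

lemma run_last: "is_run A u qs' \<Longrightarrow> last qs' \<in> states A"
proof (induction u arbitrary: qs' rule: rev_induct)
  case Nil
  then show ?case using init_states by (auto simp: is_run_def length_Suc_conv)
next
  case (snoc a u)
  then show ?case using transD by (auto elim!: is_run_snocE)
qed

lemma run_word: "is_run A u qs' \<Longrightarrow> u \<in> lists (alphabet A)"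
proof (induction u arbitrary: qs' rule: rev_induct)
  case (snoc a u)
  then show ?case using transD by (fastforce elim!: is_run_snocE)
qed simp

lemma det_step:
  assumes "is_det d" "s \<in> states A" "j < M" "es ! j = (p, a, q)"
  obtains k t where "k < M" "es ! k = (s, a, t)" "d (f s) (lab (start j)) = start k"
proof -
  note fj = fields[OF assms(3,4)]
  obtain k where k: "k < M" "d (f s) (lab (start j)) = start k" "src (start k) = f s"
    "lab (start k) = lab (start j)"
    using assms(1)[unfolded is_det_def, rule_format, OF f_less[OF assms(2)] assms(3)] by blast
  obtain s' a' t where e: "es ! k = (s', a', t)" by (cases "es ! k")
  note fk = fields[OF k(1) e]
  have "f s' = f s" using k(3) fk(1) by simp
  then have "s' = s" using f_eq_iff transD[OF fk(4)] assms(2) by simp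
  moreover have "g a' = g a" using k(4) fk(2) fj(2) by simp
  then have "a' = a" using g_eq_iff transD[OF fk(4)] transD[OF fj(4)] by simp
  ultimately show ?thesis using that[OF k(1) _ k(2)] e by simp
qed

text \<open>Both runs are extended by the letter of transition \<open>j\<close>: the second by
  \<open>j\<close> itself, the first by the transition that \<open>d\<close> chooses for this
  letter.\<close>

lemma reach_runs:
  assumes "is_det d" "(x, y) \<in> reach d"
  shows "\<exists>u qs1 qs2. is_run A u qs1 \<and> is_run A u qs2 \<and> x = f (last qs1) \<and> y = f (last qs2)"
  using assms(2)
proof (induction rule: reach.induct)
  case (reach_init i)
  have "qs ! j \<in> init A" if "j < nI" for j
    using that qs nth_mem[of j qs] by (simp add: nI_eq lengths)
  moreover have "inp 4 = f (qs ! 0)" "inp (4 + i) = f (qs ! i)"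
    using inp_init[of 0] inp_init[of i] reach_init by (auto simp: nI_eq)
  ultimately show ?case
    using reach_init by (intro exI[of _ "[]"] exI[of _ "[qs ! 0]"] exI[of _ "[qs ! i]"])
      (auto simp: is_run_def)
next
  case (reach_step x y j)
  then obtain u qs1 qs2 where r: "is_run A u qs1" "is_run A u qs2" "x = f (last qs1)"
    "y = f (last qs2)"
    by blast
  obtain p a q where e: "es ! j = (p, a, q)" by (cases "es ! j")
  have j: "j < M" "src (start j) = y" using reach_step by (auto simp: outs_def)
  note fj = fields[OF j(1) e]
  have p: "p = last qs2"
    using fj j r run_last[OF r(2)] f_eq_iff[of p "last qs2"] transD[OF fj(4)] by simp
  obtain k t where k: "k < M" "es ! k = (last qs1, a, t)" "d x (lab (start j)) = start k"
    using det_step[OF assms(1) run_last[OF r(1)] j(1) e] r(3) by blast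
  note fk = fields[OF k(1,2)]
  have "is_run A (u @ [a]) (qs1 @ [t])" "is_run A (u @ [a]) (qs2 @ [q])"
    using r fk fj p by (auto intro: is_run_snoc)
  then show ?case
    using fk fj k by (intro exI[of _ "u @ [a]"] exI[of _ "qs1 @ [t]"] exI[of _ "qs2 @ [q]"]) simp
qed

definition det_state :: "(nat \<Rightarrow> nat \<Rightarrow> nat) \<Rightarrow> 'a list \<Rightarrow> nat" where
  "det_state d u = foldl (\<lambda>s a. dst (d s (g a))) (inp 4) u"

lemma run_reach: "is_run A u qs' \<Longrightarrow> (det_state d u, f (last qs')) \<in> reach d"
proof (induction u arbitrary: qs' rule: rev_induct)
  case Nil
  then obtain q where q: "qs' = [q]" "q \<in> set qs"
    using qs by (auto simp: is_run_def length_Suc_conv)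
  then obtain i where "i < nI" "qs ! i = q"
    by (auto simp: in_set_conv_nth nI_eq lengths)
  then show ?case
    using q reach_init[of i d] by (simp add: det_state_def inp_init nI_eq)
next
  case (snoc a u)
  obtain qs0 q where q: "qs' = qs0 @ [q]" "is_run A u qs0" "(last qs0, a, q) \<in> trans A"
    using snoc.prems by (rule is_run_snocE)
  obtain j where j: "j < M" "es ! j = (last qs0, a, q)"
    using trans_index[OF q(3)] .
  note fj = fields[OF j]
  have "j \<in> outs (f (last qs0))" using fj j by (simp add: outs_def)
  from reach_step[OF snoc.IH[OF q(2)] this] show ?case
    using fj q by (simp add: det_state_def)
qed

text \<open>If \<open>A\<close> is tidy, the two runs behind a reachable pair are extended by a
  common letter, and \<theta> forces equal discount factors. Conversely the deterministic run fixes
  the last factor of every run, so \<theta> can be read off any run.\<close>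

lemma tidy_iff:
  assumes "is_det d"
  shows "tidy A \<longleftrightarrow> integral \<and> consistent d"
proof
  assume t: "tidy A"
  then have int: "integral" by (simp add: tidy_def integral_iff)
  obtain \<theta> :: "'a list \<Rightarrow> nat" where \<theta>: "\<And>u qs'. u \<in> lists (alphabet A) - {[]} \<Longrightarrow> is_run A u qs' \<Longrightarrow>
      last_discount A u qs' = of_nat (\<theta> u)"
    using t unfolding tidy_def last_discount_def by blast
  have "bits (start j) = bits (d s (lab (start j)))" if sp: "(s, p) \<in> reach d" "j \<in> outs p" for s p j
  proof -
    obtain u qs1 qs2 where r: "is_run A u qs1" "is_run A u qs2" "s = f (last qs1)"
      "p = f (last qs2)"
      using reach_runs[OF assms sp(1)] by blast
    obtain p' a q where e: "es ! j = (p', a, q)" by (cases "es ! j")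
    have j: "j < M" "src (start j) = p" using sp by (auto simp: outs_def)
    note fj = fields[OF j(1) e]
    have p': "p' = last qs2"
      using fj j r run_last[OF r(2)] f_eq_iff[of p' "last qs2"] transD[OF fj(4)] by simp
    obtain k t where k: "k < M" "es ! k = (last qs1, a, t)" "d s (lab (start j)) = start k"
      using det_step[OF assms run_last[OF r(1)] j(1) e] r(3) by blast
    have runs: "is_run A (u @ [a]) (qs1 @ [t])" "is_run A (u @ [a]) (qs2 @ [q])"
      using r fields[OF k(1,2)] fj p' by (auto intro: is_run_snoc)
    have "u @ [a] \<in> lists (alphabet A) - {[]}"
      using run_word[OF runs(1)] by simp
    then have "last_discount A (u @ [a]) (qs1 @ [t]) = last_discount A (u @ [a]) (qs2 @ [q])"
      using \<theta> runs by simp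
    then have "discount A (es ! k) = discount A (es ! j)"
      using r e k p' by (simp add: last_discount_snoc)
    then show ?thesis using k j by (simp add: bits_start)
  qed
  then show "integral \<and> consistent d"
    using int by (auto simp: consistent_def)
next
  assume ic: "integral \<and> consistent d"
  have step: "discount A e \<in> \<int> \<and> 1 < discount A e" if "e \<in> trans A" for e
    using that ic nmda by (auto simp: integral_iff integral_nmda_def is_nmda_def)
  have unique: "last_discount A (u @ [a]) qs1 = last_discount A (u @ [a]) qs2"
    if r: "is_run A (u @ [a]) qs1" "is_run A (u @ [a]) qs2" for u a qs1 qs2
  proof -
    \<comment> \<open>The digits on the right depend on the word only, not on the run; integrality
      then turns equal digits into equal discount factors.\<close>
    have "\<exists>j < M. last_discount A (u @ [a]) qs' = discount A (es ! j) \<and>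
        bits (start j) = bits (d (det_state d u) (g a))"
      if run: "is_run A (u @ [a]) qs'" for qs'
    proof -
      obtain qs0 q where q: "qs' = qs0 @ [q]" "is_run A u qs0" "(last qs0, a, q) \<in> trans A"
        using run by (rule is_run_snocE)
      obtain j where j: "j < M" "es ! j = (last qs0, a, q)"
        using trans_index[OF q(3)] .
      note fj = fields[OF j]
      have "j \<in> outs (f (last qs0))" using fj j by (simp add: outs_def)
      then have "bits (start j) = bits (d (det_state d u) (g a))"
        using ic run_reach[OF q(2), of d] fj unfolding consistent_def by fastforce
      then show ?thesis
        using j q by (auto simp: last_discount_snoc)
    qed
    from this[OF r(1)] this[OF r(2)] show ?thesis
      using bits_eq_iff ic by metis
  qed
  have "\<exists>t :: nat. t \<notin> {0, 1} \<and> (\<forall>qs'. is_run A u qs' \<longrightarrow> last_discount A u qs' = of_nat t)"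
    if "u \<noteq> []" for u
  proof (cases "\<exists>qs'. is_run A u qs'")
    case True
    then obtain qs' where run: "is_run A u qs'" by blast
    obtain v a where u: "u = v @ [a]" using \<open>u \<noteq> []\<close> rev_exhaust by blast
    obtain qs0 q where q: "qs' = qs0 @ [q]" "is_run A v qs0" "(last qs0, a, q) \<in> trans A"
      using run unfolding u by (rule is_run_snocE)
    have l: "last_discount A u qs' \<in> \<int>" "1 < last_discount A u qs'"
      using step[OF q(3)] q by (simp_all add: u last_discount_snoc)
    then obtain z where z: "last_discount A u qs' = of_int z" by (elim Ints_cases)
    then have "1 < z" using l by simp
    then have "nat z \<notin> {0, 1}" "last_discount A u qs' = of_nat (nat z)" using z by auto
    then show ?thesis
      using unique run u by metis
  next
    case False
    \<comment> \<open>A word without runs, for lack of an initial state or because of a foreign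
      letter, receives an arbitrary admissible value.\<close>
    then show ?thesis by (intro exI[of _ 2]) auto
  qed
  then obtain \<theta> :: "'a list \<Rightarrow> nat" where "\<And>u. u \<noteq> [] \<Longrightarrow> \<theta> u \<notin> {0, 1} \<and>
      (\<forall>qs'. is_run A u qs' \<longrightarrow> last_discount A u qs' = of_nat (\<theta> u))"
    by metis
  then show "tidy A"
    using ic unfolding tidy_def integral_iff last_discount_def by blast
qed

lemma initial_config_code: "initial_config code = (\<lambda>_. 0, inp)"
  by (simp add: initial_config_def inp_def fun_eq_iff)

lemma program_decides_tidy:
  "\<exists>t r m. exec ((nmda_size A + 2) ^ 9) tidy_program (initial_config code) t (r, m) \<and>
     t \<le> 120 * (nmda_size A + 1) ^ 2 \<and> r 0 = (if tidy A then 1 else 0)"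
proof -
  obtain t r m d where *: "exec ((nmda_size A + 2) ^ 9) tidy_program (\<lambda>_. 0, inp) t (r, m)"
    "t \<le> 100 + 200 * nmda_size A + 120 * nmda_size A * nmda_size A"
    "is_det d" "r 0 = (if integral \<and> consistent d then 1 else 0)"
    using tidy_program_correct unfolding wp_def by blast
  have "100 + 200 * nmda_size A + 120 * nmda_size A * nmda_size A \<le> 120 * (nmda_size A + 1) ^ 2"
    by (simp add: power2_eq_square algebra_simps)
  then have "t \<le> 120 * (nmda_size A + 1) ^ 2"
    using *(2) by (rule order.trans[rotated])
  then show ?thesis
    using *(1,4) unfolding initial_config_code tidy_iff[OF *(3)] by blast
qed

end

section \<open>Automata without transitions, and the final time bound\<close>

lemma empty_tidy:
  assumes "is_nmda A" "trans A = {}"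
  shows "tidy A"
proof -
  have "\<not> is_run A u qs" if "u \<noteq> []" for u qs
    using that assms(2) by (auto simp: is_run_def)
  then show ?thesis
    using assms(2) by (auto simp: tidy_def integral_nmda_def intro!: exI[of _ "\<lambda>_. 2"])
qed

theorem theorem5p1:
  shows "decidable_in_time {A :: (nat, nat) nmda. is_nmda A} nmda_code nmda_size tidy
           (\<lambda>n. real n ^ 2)"
  unfolding decidable_in_time_def
proof (rule exI[of _ tidy_program], rule exI[of _ 9], rule exI[of _ "\<lambda>n. 120 * (n + 1) ^ 2"],
    intro conjI ballI allI impI)
  show "(\<lambda>n. real (120 * (n + 1) ^ 2)) \<in> O(\<lambda>n. real n ^ 2)"
  \<comment> \<open>For \<open>1 \<le> n\<close> one has \<open>n + 1 \<le> 2 * n\<close>, whose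
    square gives the factor 4 in \<open>480 = 4 * 120\<close>.\<close>
  proof (rule bigoI[of _ 480])
    have "norm (real (120 * (n + 1) ^ 2)) \<le> 480 * norm (real n ^ 2)" if "1 \<le> n" for n
    proof -
      have "120 * (n + 1) ^ 2 \<le> 120 * (2 * n) ^ 2"
        using that by (intro mult_le_mono2 power_mono) auto
      also have "\<dots> = 480 * n ^ 2"
        by (simp add: power_mult_distrib)
      finally have "real (120 * (n + 1) ^ 2) \<le> real (480 * n ^ 2)"
        by (rule of_nat_mono)
      then show ?thesis by simp
    qed
    then show "eventually (\<lambda>n. norm (real (120 * (n + 1) ^ 2)) \<le> 480 * norm (real n ^ 2)) at_top"
      by (rule eventually_at_top_linorderI)
  qed
next
  fix A :: "(nat, nat) nmda" and xs
  assume A: "A \<in> {A. is_nmda A}" and "nmda_code A xs"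
  then obtain f g qs es where c:
    "bij_betw f (states A) {..<card (states A)}" "bij_betw g (alphabet A) {..<card (alphabet A)}"
    "distinct qs" "set qs = init A" "distinct es" "set es = trans A"
    "xs = [card (states A), card (alphabet A), card (init A), card (trans A)] @ map f qs @
       concat (map (\<lambda>(p, a, q). [f p, g a, f q] @ rat_code (weight A (p, a, q)) @
         rat_code (discount A (p, a, q))) es)"
    unfolding nmda_code_def by blast
  show "\<exists>t r m. exec ((nmda_size A + 2) ^ 9) tidy_program (initial_config xs) t (r, m) \<and>
    t \<le> 120 * (nmda_size A + 1) ^ 2 \<and> r 0 = (if tidy A then 1 else 0)"
  proof (cases "trans A = {}")
    case True
    \<comment> \<open>The size is 0 here, so words hold the numbers below \<open>2 ^ 9\<close>,
      ample for the constants up to 3 in the few instructions executed.\<close>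
    let ?W = "(nmda_size A + 2) ^ 9"
    have "2 ^ 9 \<le> ?W" by (intro power_mono) auto
    then have "3 < ?W" by simp
    moreover have "snd (initial_config xs) 3 = 0"
      using True by (simp add: initial_config_def c(7))
    ultimately have "wp ?W tidy_program (\<lambda>t r m. t \<le> 6 \<and> r 0 = 1)
        (fst (initial_config xs)) (snd (initial_config xs))"
      by (simp add: tidy_program_def)
    then obtain t r m where "exec ?W tidy_program (initial_config xs) t (r, m)" "t \<le> 6" "r 0 = 1"
      unfolding wp_def prod.collapse by blast
    moreover have "t \<le> 120 * (nmda_size A + 1) ^ 2"
      using one_le_power[of "nmda_size A + 1" 2] \<open>t \<le> 6\<close> by linarith
    moreover have "tidy A"
      using empty_tidy[OF _ True] A by simp
    ultimately have "exec ?W tidy_program (initial_config xs) t (r, m) \<and>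
        t \<le> 120 * (nmda_size A + 1) ^ 2 \<and> r 0 = (if tidy A then 1 else 0)"
      by simp
    then show ?thesis by blast
  next
    case False
    interpret coded_nmda A f g qs es
      by unfold_locales (use A c False in auto)
    have "xs = code"
      unfolding c(7) code_def enc_def by (simp add: split_def)
    then show ?thesis using program_decides_tidy by simp
  qed
qed

end
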